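(* Let $K$ be a finite h-regular CW-complex and let $L$ be a subcomplex of $K$. If $K$ collapses to $L$ (as CW-complexes), then the finite space $\mathcal{X}(K)$ $\gamma$-collapses to $\mathcal{X}(L)$.
   Context: For an (open) cell $e^n$ of a CW-complex, $\overline{e^n}$ denotes its closure and $\dot{e}^n$ its boundary, i.e. the image of the attaching map $S^{n-1}\to K$. A CW-complex $K$ is h-regular if the attaching map of each cell is a homotopy equivalence onto its image and the closed cells $\overline{e^n}$ are subcomplexes of $K$. The face poset $\mathcal{X}(K)$ of an h-regular complex $K$ is the set of cells of $K$ ordered by $e\le e'$ if and only if $e\subseteq\overline{e'}$. Collapses of finite CW-complexes are in the usual sense of Whitehead and Cohen: there is an elementary collapse from $K$ to a subcomplex $L$ if $K=L\cup e^n\cup e^{n+1}$ with $e^n,e^{n+1}$ cells not in $L$, and there exist a ball pair $(Q^{n+1},Q^n)$ homeomorphic to $(I^{n+1},I^n)$, with $Q^n\subseteq\partial Q^{n+1}$, and a map $\varphi:Q^{n+1}\to K$ such that $\varphi$ is a characteristic map for $e^{n+1}$, $\varphi|_{Q^n}$ is a characteristic map for $e^n$, and $\varphi(P^n)\subseteq L^{n}$ (the $n$-skeleton of $L$), where $P^n$ is the closure of $\partial Q^{n+1}\smallsetminus Q^n$. $K$ collapses to $L$, written $K\searrow L$, if there is a finite sequence of elementary collapses from $K$ to $L$. Finite posets are identified with finite $T_0$-spaces: the open sets are the down-sets. For a point $x$ of a finite $T_0$-space $X$, the link $\hat{C}_x$ is the subspace of points of $X$ different from $x$ and comparable with $x$.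 A space is homotopically trivial if all its homotopy groups are trivial (in particular it is non-empty and path-connected). A point $x\in X$ is a $\gamma$-point if $\hat{C}_x$ is homotopically trivial; in that case there is an elementary $\gamma$-collapse from $X$ to $X\smallsetminus\{x\}$. A finite $T_0$-space $X$ $\gamma$-collapses to $Y$ if there is a (finite) sequence of elementary $\gamma$-collapses that starts in $X$ and ends in $Y$. *)

theory Defs
  imports "HOL-Analysis.Analysis"
begin

section \<open>Balls, spheres and cubes\<close>

definition ball_top :: "nat \<Rightarrow> (nat \<Rightarrow> real) topology" where
  "ball_top n = subtopology (Euclidean_space n) {x. (\<Sum>i<n. (x i)\<^sup>2) \<le> 1}"

text \<open>The boundary sphere of the \<open>n\<close>-ball. It is empty for \<open>n = 0\<close>, and for \<open>n = Suc m\<close> it is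
  the underlying set of \<open>nsphere m\<close>.\<close>

definition ball_bd :: "nat \<Rightarrow> (nat \<Rightarrow> real) set" where
  "ball_bd n = {x \<in> topspace (Euclidean_space n). (\<Sum>i<n. (x i)\<^sup>2) = 1}"

definition cube_top :: "nat \<Rightarrow> (nat \<Rightarrow> real) topology" where
  "cube_top n = subtopology (Euclidean_space n) {x. \<forall>i<n. 0 \<le> x i \<and> x i \<le> 1}"

definition cube_bd :: "nat \<Rightarrow> (nat \<Rightarrow> real) set" where
  "cube_bd n = {x \<in> topspace (cube_top n). \<exists>i<n. x i = 0 \<or> x i = 1}"

text \<open>\<open>ball_pair n Q S B T\<close>: the pair \<open>(Q, B)\<close> is homeomorphic to \<open>(I\<^bsup>n+1\<^esup>, I\<^bsup>n\<^esup>)\<close>, and the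
  homeomorphism identifies \<open>S\<close> and \<open>T\<close> with the boundaries of the two cubes.
  As points of \<open>Euclidean_space n\<close> vanish from coordinate \<open>n\<close> on, the set \<open>I\<^bsup>n\<^esup>\<close> literally is the
  face \<open>I\<^bsup>n\<^esup> \<times> {0}\<close> of \<open>I\<^bsup>n+1\<^esup>\<close>; in particular \<open>B \<subseteq> S\<close>.
  Since only the homeomorphism type of the pair matters, nothing is lost by letting \<open>Q\<close> range over
  spaces with points of type \<open>nat \<Rightarrow> real\<close>.\<close>

definition ball_pair ::
  "nat \<Rightarrow> (nat \<Rightarrow> real) topology \<Rightarrow> (nat \<Rightarrow> real) set \<Rightarrow> (nat \<Rightarrow> real) set \<Rightarrow> (nat \<Rightarrow> real) set \<Rightarrow> bool"
where
  "ball_pair n Q S B T \<longleftrightarrow>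
     (\<exists>h. homeomorphic_map (cube_top (Suc n)) Q h \<and>
          S = h ` cube_bd (Suc n) \<and>
          B = h ` topspace (cube_top n) \<and>
          T = h ` cube_bd n)"


section \<open>CW-complexes\<close>

text \<open>Cells are the open cells, as subsets of the space. Each cell comes with a chosen
  characteristic map, whose restriction to the boundary sphere is the attaching map.\<close>

record 'a cw =
  cw_space :: "'a topology"
  cells :: "'a set set"
  cell_dim :: "'a set \<Rightarrow> nat"
  char_map :: "'a set \<Rightarrow> (nat \<Rightarrow> real) \<Rightarrow> 'a"

abbreviation closed_cell :: "'a cw \<Rightarrow> 'a set \<Rightarrow> 'a set" where
  "closed_cell K e \<equiv> cw_space K closure_of e"

text \<open>The index is an integer so that the skeleton of dimension \<open>-1\<close> makes sense (it is empty).\<close>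

definition skeleton :: "'a cw \<Rightarrow> int \<Rightarrow> 'a set" where
  "skeleton K j = \<Union>{e \<in> cells K. int (cell_dim K e) \<le> j}"

text \<open>\<open>\<phi>\<close> is a characteristic map for the cell \<open>e\<close>, defined on a ball \<open>Q\<close> of dimension
  \<open>cell_dim K e\<close> with boundary sphere \<open>S\<close>. That \<open>Q\<close> is such a ball is required where this
  is used.\<close>

definition characteristic_map ::
  "'a cw \<Rightarrow> 'a set \<Rightarrow> 'q topology \<Rightarrow> 'q set \<Rightarrow> ('q \<Rightarrow> 'a) \<Rightarrow> bool"
where
  "characteristic_map K e Q S \<phi> \<longleftrightarrow>
     continuous_map Q (cw_space K) \<phi> \<and>
     homeomorphic_map (subtopology Q (topspace Q - S)) (subtopology (cw_space K) e) \<phi> \<and>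
     \<phi> ` S \<subseteq> skeleton K (int (cell_dim K e) - 1)"

definition cw_complex :: "'a cw \<Rightarrow> bool" where
  "cw_complex K \<longleftrightarrow>
     Hausdorff_space (cw_space K) \<and>
     \<Union>(cells K) = topspace (cw_space K) \<and>
     pairwise disjnt (cells K) \<and>
     (\<forall>e\<in>cells K. characteristic_map K e
        (ball_top (cell_dim K e)) (ball_bd (cell_dim K e)) (char_map K e)) \<and>
     (\<forall>e\<in>cells K. \<exists>F\<subseteq>cells K. finite F \<and> closed_cell K e \<subseteq> \<Union>F) \<and>
     (\<forall>A\<subseteq>topspace (cw_space K).
        closedin (cw_space K) A \<longleftrightarrow> (\<forall>e\<in>cells K. closedin (cw_space K) (A \<inter> closed_cell K e)))"

definition finite_cw_complex :: "'a cw \<Rightarrow> bool" where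
  "finite_cw_complex K \<longleftrightarrow> cw_complex K \<and> finite (cells K)"

definition subcomplex_cells :: "'a cw \<Rightarrow> 'a set set \<Rightarrow> bool" where
  "subcomplex_cells K F \<longleftrightarrow> F \<subseteq> cells K \<and> (\<forall>e\<in>F. closed_cell K e \<subseteq> \<Union>F)"

definition subcomplex :: "'a cw \<Rightarrow> 'a cw \<Rightarrow> bool" where
  "subcomplex L K \<longleftrightarrow>
     (\<exists>F. subcomplex_cells K F \<and>
          L = K\<lparr>cw_space := subtopology (cw_space K) (\<Union>F), cells := F\<rparr>)"


section \<open>h-regular complexes and their face posets\<close>

definition homotopy_equivalence_map ::
  "'a topology \<Rightarrow> 'b topology \<Rightarrow> ('a \<Rightarrow> 'b) \<Rightarrow> bool"
where
  "homotopy_equivalence_map X Y f \<longleftrightarrow>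
     continuous_map X Y f \<and>
     (\<exists>g. continuous_map Y X g \<and>
          homotopic_with (\<lambda>_. True) X X (g \<circ> f) id \<and>
          homotopic_with (\<lambda>_. True) Y Y (f \<circ> g) id)"

definition cell_boundary :: "'a cw \<Rightarrow> 'a set \<Rightarrow> 'a set" where
  "cell_boundary K e = char_map K e ` ball_bd (cell_dim K e)"

definition h_regular :: "'a cw \<Rightarrow> bool" where
  "h_regular K \<longleftrightarrow>
     (\<forall>e\<in>cells K.
        homotopy_equivalence_map
          (subtopology (Euclidean_space (cell_dim K e)) (ball_bd (cell_dim K e)))
          (subtopology (cw_space K) (cell_boundary K e))
          (char_map K e) \<and>
        (\<exists>F. subcomplex_cells K F \<and> closed_cell K e = \<Union>F))"

text \<open>A poset, given by a carrier and an order, as a space: the open sets are the down-sets.\<close>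

definition poset_top :: "'b set \<Rightarrow> ('b \<Rightarrow> 'b \<Rightarrow> bool) \<Rightarrow> 'b topology" where
  "poset_top A le = topology (\<lambda>U. U \<subseteq> A \<and> (\<forall>y\<in>U. \<forall>x\<in>A. le x y \<longrightarrow> x \<in> U))"

lemma openin_poset_top:
  "openin (poset_top A le) U \<longleftrightarrow> U \<subseteq> A \<and> (\<forall>y\<in>U. \<forall>x\<in>A. le x y \<longrightarrow> x \<in> U)"
proof -
  have "istopology (\<lambda>U. U \<subseteq> A \<and> (\<forall>y\<in>U. \<forall>x\<in>A. le x y \<longrightarrow> x \<in> U))"
    unfolding istopology_def by blast
  then show ?thesis
    by (simp add: poset_top_def topology_inverse')
qed

definition face_poset :: "'a cw \<Rightarrow> 'a set topology" where
  "face_poset K = poset_top (cells K) (\<lambda>e e'. e \<subseteq> closed_cell K e')"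


section \<open>Collapses of CW-complexes\<close>

definition elementary_collapse :: "'a cw \<Rightarrow> 'a cw \<Rightarrow> bool" where
  "elementary_collapse K L \<longleftrightarrow>
     subcomplex L K \<and>
     (\<exists>n e e'. e \<notin> cells L \<and> e' \<notin> cells L \<and>
        cells K = cells L \<union> {e, e'} \<and>
        cell_dim K e = n \<and> cell_dim K e' = Suc n \<and>
        (\<exists>Q S B T \<phi>. ball_pair n Q S B T \<and>
           characteristic_map K e' Q S \<phi> \<and>
           characteristic_map K e (subtopology Q B) T \<phi> \<and>
           \<phi> ` (Q closure_of (S - B)) \<subseteq> skeleton L (int n)))"

definition collapses :: "'a cw \<Rightarrow> 'a cw \<Rightarrow> bool" where
  "collapses = elementary_collapse\<^sup>*\<^sup>*"


section \<open>Homotopically trivial spaces\<close>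

text \<open>Maps \<open>(I\<^bsup>n\<^esup>, \<partial>I\<^bsup>n\<^esup>) \<rightarrow> (X, x)\<close> up to homotopy relative to the boundary. Only the underlying
  set of the homotopy group is defined: the group is trivial iff this set is a singleton.\<close>

definition spheroids :: "nat \<Rightarrow> 'b topology \<Rightarrow> 'b \<Rightarrow> ((nat \<Rightarrow> real) \<Rightarrow> 'b) set" where
  "spheroids n X x = {f. continuous_map (cube_top n) X f \<and> f ` cube_bd n \<subseteq> {x}}"

definition spheroid_homotopy ::
  "nat \<Rightarrow> 'b topology \<Rightarrow> 'b \<Rightarrow> (((nat \<Rightarrow> real) \<Rightarrow> 'b) \<times> ((nat \<Rightarrow> real) \<Rightarrow> 'b)) set"
where
  "spheroid_homotopy n X x =
     {(f, g). homotopic_with (\<lambda>k. k ` cube_bd n \<subseteq> {x}) (cube_top n) X f g}"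

definition homotopy_group_set :: "nat \<Rightarrow> 'b topology \<Rightarrow> 'b \<Rightarrow> ((nat \<Rightarrow> real) \<Rightarrow> 'b) set set" where
  "homotopy_group_set n X x = spheroids n X x // spheroid_homotopy n X x"

lemma equiv_spheroid_homotopy: "equiv (spheroids n X x) (spheroid_homotopy n X x)"
proof (rule equivI)
  show "spheroid_homotopy n X x \<subseteq> spheroids n X x \<times> spheroids n X x"
  proof (rule subrelI)
    fix f g
    assume "(f, g) \<in> spheroid_homotopy n X x"
    then have h: "homotopic_with (\<lambda>k. k ` cube_bd n \<subseteq> {x}) (cube_top n) X f g"
      unfolding spheroid_homotopy_def mem_Collect_eq case_prod_conv .
    show "(f, g) \<in> spheroids n X x \<times> spheroids n X x"
      unfolding spheroids_def mem_Times_iff mem_Collect_eq fst_conv snd_conv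
      by (intro conjI homotopic_with_imp_continuous_maps[OF h, THEN conjunct1]
          homotopic_with_imp_continuous_maps[OF h, THEN conjunct2]
          homotopic_with_imp_property[OF h, THEN conjunct1]
          homotopic_with_imp_property[OF h, THEN conjunct2])
  qed
  show "refl_on (spheroids n X x) (spheroid_homotopy n X x)"
    unfolding refl_on_def spheroid_homotopy_def spheroids_def
    by (simp add: homotopic_with_refl)
  show "sym (spheroid_homotopy n X x)"
    unfolding sym_def spheroid_homotopy_def mem_Collect_eq case_prod_conv
    by (intro allI impI) (rule homotopic_with_symD)
  show "trans (spheroid_homotopy n X x)"
    unfolding trans_def spheroid_homotopy_def mem_Collect_eq case_prod_conv
    by (intro allI impI) (rule homotopic_with_trans)
qed

definition homotopically_trivial :: "'b topology \<Rightarrow> bool" where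
  "homotopically_trivial X \<longleftrightarrow>
     topspace X \<noteq> {} \<and>
     path_connected_space X \<and>
     (\<forall>n\<ge>1. \<forall>x\<in>topspace X. is_singleton (homotopy_group_set n X x))"


section \<open>gamma-collapses of finite T0-spaces\<close>

text \<open>The order of a finite T0-space whose open sets are the down-sets: \<open>x \<le> y\<close> iff \<open>x\<close> lies in
  the smallest open set containing \<open>y\<close>.\<close>

definition space_le :: "'b topology \<Rightarrow> 'b \<Rightarrow> 'b \<Rightarrow> bool" where
  "space_le X x y \<longleftrightarrow>
     x \<in> topspace X \<and> y \<in> topspace X \<and> (\<forall>U. openin X U \<and> y \<in> U \<longrightarrow> x \<in> U)"

definition link :: "'b topology \<Rightarrow> 'b \<Rightarrow> 'b topology" where
  "link X x = subtopology X {y \<in> topspace X. y \<noteq> x \<and> (space_le X x y \<or> space_le X y x)}"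

definition gamma_point :: "'b topology \<Rightarrow> 'b \<Rightarrow> bool" where
  "gamma_point X x \<longleftrightarrow> x \<in> topspace X \<and> homotopically_trivial (link X x)"

definition elementary_gamma_collapse :: "'b topology \<Rightarrow> 'b topology \<Rightarrow> bool" where
  "elementary_gamma_collapse X Y \<longleftrightarrow>
     finite (topspace X) \<and> t0_space X \<and>
     (\<exists>x. gamma_point X x \<and> Y = subtopology X (topspace X - {x}))"

definition gamma_collapses :: "'b topology \<Rightarrow> 'b topology \<Rightarrow> bool" where
  "gamma_collapses = elementary_gamma_collapse\<^sup>*\<^sup>*"

end

theory Submission
  imports Defs
begin

text \<open>An elementary collapse removes a cell \<open>e\<close> together with a cell \<open>e'\<close> of which it is a free
  face. In the face poset, \<open>e\<close> goes first: its link has the maximum \<open>e'\<close> and is contractible. After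
  that, the link of \<open>e'\<close> is the face poset of the subcomplex \<open>L'\<close> that remains of the closed
  cell of \<open>e'\<close>. Closed cells are contractible, because a ball attached along a homotopy equivalence is,
  and \<open>L'\<close> is a retract of such a cell, hence contractible too.

  It remains to see that a contractible subcomplex \<open>L'\<close> with face poset \<open>X\<close> has every map
  \<open>f: Z \<rightarrow> X\<close> from a normal space null-homotopic. Collars give a map \<open>p: L' \<rightarrow> X\<close> that sends each closed
  cell into the set of its faces. As closed cells are contractible, there are \<open>f' \<ge> f\<close> and \<open>g: Z \<rightarrow> L'\<close>
  such that \<open>g z\<close> lies in the closed cell of \<open>f' z\<close>. Then \<open>p \<circ> g \<le> f' \<ge> f\<close>, and comparable maps into a
  finite space are homotopic, so \<open>f\<close> factors up to homotopy through the contractible space \<open>L'\<close>.\<close>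

section \<open>Posets as topological spaces\<close>

text \<open>Closed cells of an h-regular complex need not be balls, so the order complex of the face
  poset is in general not homeomorphic to the complex, and the link of \<open>e'\<close> cannot be
  recognised by subdivision. Hence \<open>L'\<close> and its face poset are compared through maps,
  and only in one direction: maps into the poset are factored through \<open>L'\<close>. Raising
  \<open>f\<close> to \<open>f'\<close> answers a real obstacle. Along an arc, \<open>f\<close> may
  equal one endpoint of an edge, then the edge itself at a single point, then the other endpoint. A
  map \<open>g\<close> with values in the closed cells of \<open>f z\<close> itself would have to
  jump. If the value may grow on a neighbourhood of that point, \<open>g\<close> has room to cross
  the edge. Normality of \<open>Z\<close> supplies the Urysohn functions for this, and it holds for
  the test spaces that detect homotopy groups, namely a two-point space and boundaries of cubes. The
  free face provides the retraction onto \<open>L'\<close>: the characteristic map of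
  \<open>e'\<close> makes no identifications on the interior of the cube or of its free face, so a
  retraction of the cube onto the remaining faces descends to the closed cell.\<close>

lemma topspace_poset_top [simp]: "topspace (poset_top A le) = A"
  by (auto simp: topspace_def openin_poset_top)

lemma subtopology_poset_top:
  assumes "transp_on A le"
  shows "subtopology (poset_top A le) B = poset_top (A \<inter> B) le"
proof (rule topology_eq[THEN iffD2], intro allI)
  fix U
  show "openin (subtopology (poset_top A le) B) U = openin (poset_top (A \<inter> B) le) U"
  proof
    assume "openin (subtopology (poset_top A le) B) U"
    then show "openin (poset_top (A \<inter> B) le) U"
      by (auto simp: openin_subtopology openin_poset_top)
  next
    assume U: "openin (poset_top (A \<inter> B) le) U"
    \<comment> \<open>The down-closure of \<open>U\<close> in \<open>A\<close>, open by
      transitivity. Points of \<open>U\<close> are listed separately because \<open>le\<close> need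
      not be reflexive here.\<close>
    let ?V = "{x \<in> A. x \<in> U \<or> (\<exists>y\<in>U. le x y)}"
    have "openin (poset_top A le) ?V"
      using U assms unfolding openin_poset_top transp_on_def by blast
    moreover have "U = ?V \<inter> B"
      using U unfolding openin_poset_top by blast
    ultimately show "openin (subtopology (poset_top A le) B) U"
      unfolding openin_subtopology by blast
  qed
qed

lemma space_le_poset_top:
  assumes "transp_on A le" "reflp_on A le"
  shows "space_le (poset_top A le) x y \<longleftrightarrow> x \<in> A \<and> y \<in> A \<and> le x y"
proof
  assume s: "space_le (poset_top A le) x y"
  then have xy: "x \<in> A" "y \<in> A" by (auto simp: space_le_def)
  have "openin (poset_top A le) {z\<in>A. le z y}"
    using assms(1) xy unfolding openin_poset_top transp_on_def by blast
  with s xy assms(2) show "x \<in> A \<and> y \<in> A \<and> le x y"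
    unfolding space_le_def reflp_on_def by blast
qed (auto simp: space_le_def openin_poset_top)

text \<open>The homotopy stays at the smaller map for all times below 1 and jumps to the larger one
  at time 1. Open sets are down-sets, so \<open>g z\<close> in \<open>U\<close> forces
  \<open>f z\<close> in \<open>U\<close>, and the preimage of \<open>U\<close> is a union of two
  open products.\<close>

lemma homotopic_with_le_poset_top:
  assumes f: "continuous_map Z (poset_top A le) f"
    and g: "continuous_map Z (poset_top A le) g"
    and le: "\<And>z. z \<in> topspace Z \<Longrightarrow> le (f z) (g z)"
  shows "homotopic_with (\<lambda>_. True) Z (poset_top A le) f g"
  unfolding homotopic_with_def
proof (intro exI conjI allI ballI)
  let ?P = "prod_topology (top_of_set {0..1::real}) Z"
  let ?h = "\<lambda>(t::real,z). if t = 1 then g z else f z"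
  show "continuous_map ?P (poset_top A le) ?h"
    unfolding continuous_map_def
  proof (intro conjI allI impI)
    show "?h \<in> topspace ?P \<rightarrow> topspace (poset_top A le)"
      using f g by (auto simp: continuous_map_def Pi_iff)
  next
    fix U assume U: "openin (poset_top A le) U"
    have oI: "openin (top_of_set {0..1}) ({0..1} - {1::real})"
      by (simp add: openin_diff)
    have fU: "openin Z {z \<in> topspace Z. f z \<in> U}" and gU: "openin Z {z \<in> topspace Z. g z \<in> U}"
      using f g U by (auto simp: continuous_map_def)
    have *: "f z \<in> U" if "z \<in> topspace Z" "g z \<in> U" for z
      using U le[OF that(1)] f that by (auto simp: openin_poset_top continuous_map_def Pi_iff)
    have "{x \<in> topspace ?P. ?h x \<in> U}
        = ({0..1} - {1}) \<times> {z \<in> topspace Z. f z \<in> U} \<union> {0..1} \<times> {z \<in> topspace Z. g z \<in> U}"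
      using * by (auto split: if_splits)
    moreover have "openin ?P \<dots>"
      by (intro openin_Un openin_prod_Times_iff[THEN iffD2] disjI2 conjI oI fU gU) auto
    ultimately show "openin ?P {x \<in> topspace ?P. ?h x \<in> U}" by simp
  qed
qed auto

lemma contractible_poset_top_with_top:
  assumes "m \<in> A" "\<And>x. x \<in> A \<Longrightarrow> le x m"
  shows "contractible_space (poset_top A le)"
  unfolding contractible_space_def
  by (intro exI[of _ m] homotopic_with_le_poset_top) (use assms in auto)

text \<open>The induction removes a maximal element \<open>c\<close> of \<open>A\<close>. A Urysohn function \<open>u\<close> for \<open>f -` {c}\<close> drives the
  contraction of \<open>\<Phi> c\<close>, and \<open>f'\<close> takes the value \<open>c\<close> on a closed neighbourhood. The finitely many
  closed constraints \<open>(B, D)\<close> keep \<open>f'\<close> below \<open>c\<close> near that neighbourhood in the smaller poset.\<close>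

lemma poset_selection:
  fixes Z :: "'z topology" and Y :: "'y topology" and \<Phi> :: "'b \<Rightarrow> 'y set"
  assumes "finite A" "transp_on A le" "reflp_on A le" "antisymp_on A le"
    and "\<And>a. a \<in> A \<Longrightarrow> \<Phi> a \<subseteq> topspace Y"
    and "\<And>a. a \<in> A \<Longrightarrow> \<Phi> a \<noteq> {}"
    and "\<And>a. a \<in> A \<Longrightarrow> contractible_space (subtopology Y (\<Phi> a))"
    and "\<And>a b. a \<in> A \<Longrightarrow> b \<in> A \<Longrightarrow> le a b \<Longrightarrow> \<Phi> a \<subseteq> \<Phi> b"
    and "normal_space Z" "continuous_map Z (poset_top A le) f"
    and "finite \<B>"
    and "\<And>B D. (B, D) \<in> \<B> \<Longrightarrow> closedin Z B \<and> openin (poset_top A le) D \<and> f ` B \<subseteq> D"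
  shows "\<exists>f' g. continuous_map Z (poset_top A le) f' \<and> continuous_map Z Y g \<and>
           (\<forall>z\<in>topspace Z. le (f z) (f' z) \<and> g z \<in> \<Phi> (f' z)) \<and>
           (\<forall>(B, D)\<in>\<B>. f' ` B \<subseteq> D)"
  using assms
proof (induction "card A" arbitrary: A Z f \<B>)
  case 0
  then have "f \<in> topspace Z \<rightarrow> {}" by (auto simp: continuous_map_def)
  then have "topspace Z = {}" by blast
  then have "Z = trivial_topology" by (metis null_topspace_iff_trivial)
  moreover have "B = {}" if "(B,D) \<in> \<B>" for B D
    using "0.prems"(12)[OF that] closedin_subset \<open>topspace Z = {}\<close> by fastforce
  ultimately show ?case
    by (intro exI[of _ "\<lambda>_. undefined"]) fastforce
next
  case (Suc m)
  note fin = Suc.prems(1) and tr = Suc.prems(2) and rf = Suc.prems(3) and as = Suc.prems(4)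
    and \<Phi>s = Suc.prems(5) and \<Phi>ne = Suc.prems(6) and \<Phi>c = Suc.prems(7) and \<Phi>m = Suc.prems(8)
    and nZ = Suc.prems(9) and f = Suc.prems(10) and fB = Suc.prems(11) and B = Suc.prems(12)
  have ne: "A \<noteq> {}" using Suc.hyps(2) by auto
  have trP: "transp_on A (\<lambda>x y. le x y \<and> x \<noteq> y)"
    using tr as unfolding transp_on_def antisymp_on_def by blast
  obtain c where c: "c \<in> A" and cmax: "\<And>x. x \<in> A \<Longrightarrow> le c x \<Longrightarrow> x = c"
  proof -
    have "\<exists>m\<in>A. \<forall>x\<in>A. x \<noteq> m \<longrightarrow> \<not> (\<lambda>x y. le x y \<and> x \<noteq> y) m x"
      by (rule Finite_Set.bex_max_element[OF fin])
         (use trP ne as in \<open>auto simp: asymp_on_def antisymp_on_def\<close>)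
    then show ?thesis using that by blast
  qed
  define U where "U = {x \<in> A. le x c}"
  define A' where "A' = A - {c}"
  have openA': "openin (poset_top A le) D \<Longrightarrow> openin (poset_top A' le) (D - {c})" for D
    unfolding openin_poset_top A'_def by blast
  have oU: "openin (poset_top A le) U"
    using tr c unfolding U_def openin_poset_top transp_on_def by blast
  have cU: "c \<in> U" using c rf by (auto simp: U_def reflp_on_def)
  have pA': "poset_top A' le = subtopology (poset_top A le) A'"
    by (simp add: subtopology_poset_top[OF tr] A'_def Int_Diff Int_absorb1)
  define A0 where "A0 = {z \<in> topspace Z. f z \<in> {c}}"
  \<comment> \<open>On \<open>W\<close> the raised map may take the value \<open>c\<close>: there
    \<open>f\<close> lies below \<open>c\<close>, and no constraint that excludes \<open>c\<close>
    is in force.\<close>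
  define W where "W = {z \<in> topspace Z. f z \<in> U} - \<Union>{B | B D. (B,D) \<in> \<B> \<and> c \<notin> D}"
  have clA0: "closedin Z A0"
    unfolding A0_def
  proof (rule closedin_continuous_map_preimage[OF f])
    have "openin (poset_top A le) (A - {c})"
      using cmax unfolding openin_poset_top by blast
    then show "closedin (poset_top A le) {c}"
      using c by (simp add: closedin_def)
  qed
  have finB: "finite {B | B D. (B,D) \<in> \<B> \<and> c \<notin> D}"
  proof (rule finite_subset)
    show "{B | B D. (B,D) \<in> \<B> \<and> c \<notin> D} \<subseteq> fst ` \<B>" by force
  qed (use fB in auto)
  have oW: "openin Z W"
    unfolding W_def
    by (intro openin_diff openin_continuous_map_preimage[OF f oU] closedin_Union finB)
       (use B in auto)
  have A0W: "A0 \<subseteq> W"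
    using cU B by (fastforce simp: A0_def W_def)
  obtain u where cu: "continuous_map Z euclideanreal u"
    and u1: "u ` A0 \<subseteq> {1}" and u0: "u ` (topspace Z - W) \<subseteq> {0}"
  proof -
    have "disjnt A0 (topspace Z - W)" using A0W by (auto simp: disjnt_def)
    moreover have "closedin Z (topspace Z - W)" using oW by blast
    ultimately show ?thesis
      using Urysohn_lemma_alt[OF nZ clA0, of "topspace Z - W" 1 0] that by blast
  qed
  \<comment> \<open>The two sets overlap in the strip where \<open>u\<close> lies between 1/3 and
    2/3. On \<open>M\<close>, which misses \<open>A0\<close>, the map \<open>f\<close> avoids
    \<open>c\<close> and the induction hypothesis applies; on \<open>N\<close>, which lies in
    \<open>W\<close>, the value becomes \<open>c\<close>. The strip is the room in which
    \<open>g0\<close> is contracted inside \<open>\<Phi> c\<close>.\<close>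
  define M where "M = {z \<in> topspace Z. u z \<in> {..2/3}}"
  define N where "N = {z \<in> topspace Z. u z \<in> {1/3..}}"
  have clM: "closedin Z M" unfolding M_def
    by (rule closedin_continuous_map_preimage[OF cu]) simp
  have clN: "closedin Z N" unfolding N_def
    by (rule closedin_continuous_map_preimage[OF cu]) simp
  have NW: "N \<subseteq> W" using u0 by (force simp: N_def)
  have MA0: "M \<inter> A0 = {}" using u1 by (force simp: M_def)
  have Mt: "M \<subseteq> topspace Z" by (auto simp: M_def)
  \<comment> \<open>The new constraint keeps \<open>f0\<close> strictly below \<open>c\<close> on
    the strip. This makes \<open>f1\<close> continuous and puts \<open>g0\<close> into
    \<open>\<Phi> c\<close> there. The old constraints are inherited on \<open>M\<close>.\<close>
  define \<B>' where "\<B>' = insert (M \<inter> N, U - {c}) ((\<lambda>(B,D). (B \<inter> M, D - {c})) ` \<B>)"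
  have f': "continuous_map (subtopology Z M) (poset_top A' le) f"
    unfolding pA' continuous_map_in_subtopology
  proof
    show "f \<in> topspace (subtopology Z M) \<rightarrow> A'"
      using f MA0 unfolding A'_def A0_def continuous_map_def by auto
  qed (rule continuous_map_from_subtopology[OF f])
  have "\<exists>f' g. continuous_map (subtopology Z M) (poset_top A' le) f' \<and>
           continuous_map (subtopology Z M) Y g \<and>
           (\<forall>z\<in>topspace (subtopology Z M). le (f z) (f' z) \<and> g z \<in> \<Phi> (f' z)) \<and>
           (\<forall>(B, D)\<in>\<B>'. f' ` B \<subseteq> D)"
  proof (rule Suc.hyps(1))
    show "m = card A'" using Suc.hyps(2) c fin by (simp add: A'_def)
    show "transp_on A' le" "reflp_on A' le" "antisymp_on A' le"
      using tr rf as unfolding A'_def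
      by (blast intro: transp_on_subset reflp_on_subset antisymp_on_subset)+
    show "normal_space (subtopology Z M)"
      by (rule normal_space_closed_subtopology[OF nZ clM])
    show "finite \<B>'" using fB by (simp add: \<B>'_def)
    show "closedin (subtopology Z M) B \<and> openin (poset_top A' le) D \<and> f ` B \<subseteq> D"
      if BD: "(B,D) \<in> \<B>'" for B D
    proof -
      consider "B = M \<inter> N" "D = U - {c}" |
        B0 D0 where "(B0,D0) \<in> \<B>" "B = B0 \<inter> M" "D = D0 - {c}"
        using BD unfolding \<B>'_def by auto
      then show ?thesis
      proof cases
        case 1
        have "f ` (M \<inter> N) \<subseteq> U - {c}"
          using NW MA0 by (auto simp: W_def A0_def)
        then show ?thesis
          using 1 openA'[OF oU] clM clN by (auto simp: closedin_closed_subtopology intro: closedin_Int)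
      next
        case 2
        have "f ` (B0 \<inter> M) \<subseteq> D0 - {c}"
          using B[OF 2(1)] MA0 Mt by (auto simp: A0_def)
        then show ?thesis
          using 2 B[OF 2(1)] openA' clM by (auto simp: closedin_closed_subtopology intro: closedin_Int)
      qed
    qed
    show "continuous_map (subtopology Z M) (poset_top A' le) f" by (rule f')
    show "finite A'" using fin by (simp add: A'_def)
    show "\<Phi> a \<subseteq> topspace Y" "\<Phi> a \<noteq> {}" "contractible_space (subtopology Y (\<Phi> a))"
      if "a \<in> A'" for a
      using that \<Phi>s \<Phi>ne \<Phi>c by (simp_all add: A'_def)
    show "\<Phi> a \<subseteq> \<Phi> b" if "a \<in> A'" "b \<in> A'" "le a b" for a b
      using that \<Phi>m by (simp add: A'_def)
  qed
  then obtain f0 g0 where f0: "continuous_map (subtopology Z M) (poset_top A' le) f0"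
    and g0: "continuous_map (subtopology Z M) Y g0"
    and fg: "\<forall>z\<in>topspace (subtopology Z M). le (f z) (f0 z) \<and> g0 z \<in> \<Phi> (f0 z)"
    and Bf: "\<forall>(B, D)\<in>\<B>'. f0 ` B \<subseteq> D"
    by (elim exE conjE) (rule that)
  have fg0: "le (f z) (f0 z) \<and> g0 z \<in> \<Phi> (f0 z)" if "z \<in> M" for z
    using fg that Mt by (auto simp del: mem_Collect_eq)
  have B0: "f0 ` B \<subseteq> D" if "(B,D) \<in> \<B>'" for B D
    using bspec[OF Bf that] by simp
  have f0A: "f0 z \<in> A'" if "z \<in> M" for z
    using f0 that Mt by (auto simp: continuous_map_def)
  have f0N: "f0 z \<in> U - {c}" if "z \<in> M" "z \<in> N" for z
    using B0[of "M \<inter> N" "U - {c}"] that by (auto simp: \<B>'_def)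
  define f1 where "f1 = (\<lambda>z. if 1/3 \<le> u z then c else f0 z)"
  have cf1: "continuous_map Z (poset_top A le) f1"
    unfolding continuous_map_def
  proof (intro conjI allI impI)
    show "f1 \<in> topspace Z \<rightarrow> topspace (poset_top A le)"
      using c f0A by (auto simp: f1_def M_def A'_def)
  next
    fix D assume D: "openin (poset_top A le) D"
    have o23: "openin Z {z \<in> topspace Z. u z \<in> {..<2/3}}"
      by (rule openin_continuous_map_preimage[OF cu]) simp
    have o13: "openin Z {z \<in> topspace Z. u z \<in> {1/3<..}}"
      by (rule openin_continuous_map_preimage[OF cu]) simp
    have o13': "openin Z {z \<in> topspace Z. u z \<in> {..<1/3}}"
      by (rule openin_continuous_map_preimage[OF cu]) simp
    have "openin (subtopology Z M) {z \<in> topspace (subtopology Z M). f0 z \<in> D - {c}}"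
      by (rule openin_continuous_map_preimage[OF f0 openA'[OF D]])
    then obtain V where V: "openin Z V" "{z \<in> M. f0 z \<in> D - {c}} = V \<inter> M"
      using Mt by (auto simp: openin_subtopology topspace_subtopology_subset)
    have VD: "z \<in> V \<longleftrightarrow> f0 z \<in> D - {c}" if "z \<in> M" for z
      using V(2) that by blast
    have inM: "z \<in> M \<longleftrightarrow> u z \<le> 2/3" if "z \<in> topspace Z" for z
      using that by (simp add: M_def)
    show "openin Z {z \<in> topspace Z. f1 z \<in> D}"
    proof (cases "c \<in> D")
      case True
      \<comment> \<open>The critical points have \<open>u z = 1/3\<close>, where \<open>f1\<close>
        jumps to \<open>c\<close>. There \<open>f0\<close> lies in \<open>U\<close>, hence in
        \<open>D\<close>, and by continuity \<open>f0\<close> remains in \<open>D\<close>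
        nearby.\<close>
      have UD: "U \<subseteq> D" using True D unfolding U_def openin_poset_top by blast
      have "{z \<in> topspace Z. f1 z \<in> D} =
          {z \<in> topspace Z. u z \<in> {1/3<..}} \<union> ({z \<in> topspace Z. u z \<in> {..<2/3}} \<inter> V)"
        (is "?l = ?r")
      proof (intro equalityI subsetI)
        fix z assume z: "z \<in> ?l"
        show "z \<in> ?r"
        proof (cases "u z > 1/3")
          case False
          then have zM: "z \<in> M" using z by (auto simp: M_def)
          have "f0 z \<in> D - {c}"
            using z f0A[OF zM] f0N[OF zM] UD False by (auto simp: f1_def N_def A'_def split: if_splits)
          then have "z \<in> V" using VD[OF zM] by blast
          then show ?thesis using False z by auto
        qed (use z in auto)
      next
        fix z assume "z \<in> ?r"
        moreover have "f0 z \<in> D" if "u z < 2/3" "z \<in> V" "z \<in> topspace Z"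
          using that VD[of z] inM[of z] by simp
        ultimately show "z \<in> ?l" using True by (auto simp: f1_def)
      qed
      then show ?thesis using o13 o23 V by (auto intro: openin_Un openin_Int)
    next
      case False
      have "{z \<in> topspace Z. f1 z \<in> D} = {z \<in> topspace Z. u z \<in> {..<1/3}} \<inter> V"
      proof -
        have "f1 z \<in> D \<longleftrightarrow> u z \<in> {..<1/3} \<and> z \<in> V" if "z \<in> topspace Z" for z
        proof (cases "1/3 \<le> u z")
          case True
          then show ?thesis using False by (simp add: f1_def)
        next
          case uz: False
          moreover have "f0 z \<in> D \<Longrightarrow> f0 z \<noteq> c" using False by blast
          ultimately show ?thesis using VD[of z] inM[OF that] by (auto simp: f1_def)
        qed
        then show ?thesis by blast
      qed
      then show ?thesis using o13' V by auto
    qed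
  qed
  obtain a where hom: "homotopic_with (\<lambda>_. True) (subtopology Y (\<Phi> c)) (subtopology Y (\<Phi> c)) id (\<lambda>_. a)"
    using \<Phi>c[OF c] by (auto simp: contractible_space_def)
  obtain y where "y \<in> topspace (subtopology Y (\<Phi> c))"
    using \<Phi>ne[OF c] \<Phi>s[OF c] unfolding topspace_subtopology by blast
  then have "a \<in> topspace (subtopology Y (\<Phi> c))"
    using homotopic_with_imp_continuous_maps[OF hom] unfolding continuous_map_def by blast
  then have a: "a \<in> \<Phi> c" unfolding topspace_subtopology by blast
  obtain h where h: "continuous_map (prod_topology (top_of_set {0..1::real}) (subtopology Y (\<Phi> c))) (subtopology Y (\<Phi> c)) h"
    and h0: "\<And>y. h (0,y) = y" and h1: "\<And>y. h (1,y) = a"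
    using hom by (auto simp: homotopic_with_def)
  \<comment> \<open>Across the strip the time \<open>3 * u z - 1\<close> runs from 0 to 1, that is,
    from the identity of \<open>\<Phi> c\<close> to the constant \<open>a\<close>.\<close>
  define g1 where "g1 = (\<lambda>z. if u z \<le> 1/3 then g0 z else if u z \<le> 2/3 then h (3 * u z - 1, g0 z) else a)"
  have g0c: "g0 z \<in> \<Phi> c" if "z \<in> M" "z \<in> N" for z
    using fg0[OF that(1)] f0N[OF that] \<Phi>m[of "f0 z" c] c by (auto simp: U_def)
  have g1c: "g1 z \<in> \<Phi> c" if "z \<in> N" for z
  proof -
    have "h (3 * u z - 1, g0 z) \<in> \<Phi> c" if "1/3 \<le> u z" "u z \<le> 2/3"
    proof -
      have "g0 z \<in> \<Phi> c" using g0c[of z] that \<open>z \<in> N\<close> by (auto simp: M_def N_def)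
      then have "(3 * u z - 1, g0 z) \<in> topspace (prod_topology (top_of_set {0..1::real}) (subtopology Y (\<Phi> c)))"
        using that \<Phi>s[OF c] by auto
      with h show ?thesis unfolding continuous_map_def by fastforce
    qed
    then show ?thesis using g0c[of z] that a by (auto simp: g1_def M_def N_def)
  qed
  have cg1: "continuous_map Z Y g1"
    unfolding g1_def
  proof (intro continuous_map_cases_le cu continuous_map_const[THEN iffD2] disjI2)
    show "continuous_map (subtopology Z {x \<in> topspace Z. u x \<le> 1/3}) Y g0"
      by (rule continuous_map_from_subtopology_mono[OF g0]) (auto simp: M_def)
    let ?S = "subtopology (subtopology Z {x \<in> topspace Z. 1/3 \<le> u x})
       {x \<in> topspace (subtopology Z {x \<in> topspace Z. 1/3 \<le> u x}). u x \<le> 2/3}"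
    have S: "?S = subtopology Z (M \<inter> N)"
      by (auto simp: subtopology_subtopology M_def N_def intro!: arg_cong[where f="subtopology Z"])
    show "continuous_map ?S Y (\<lambda>z. h (3 * u z - 1, g0 z))"
      unfolding S
    proof (rule continuous_map_into_fulltopology, rule continuous_map_compose[OF _ h, unfolded o_def])
      have "continuous_map (subtopology Z (M \<inter> N)) (top_of_set {0..1}) (\<lambda>z. 3 * u z - 1)"
        unfolding continuous_map_in_subtopology
        by (intro conjI continuous_intros continuous_map_from_subtopology[OF cu]) (auto simp: M_def N_def)
      moreover have "continuous_map (subtopology Z (M \<inter> N)) (subtopology Y (\<Phi> c)) g0"
        unfolding continuous_map_in_subtopology
        by (intro conjI continuous_map_from_subtopology_mono[OF g0]) (auto simp: g0c)
      ultimately show "continuous_map (subtopology Z (M \<inter> N))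
          (prod_topology (top_of_set {0..1}) (subtopology Y (\<Phi> c))) (\<lambda>z. (3 * u z - 1, g0 z))"
        by (simp add: continuous_map_pairwise o_def)
    qed
    show "continuous_map (subtopology Z {x \<in> topspace Z. 1/3 \<le> u x}) euclideanreal u"
      by (rule continuous_map_from_subtopology[OF cu])
    show "a \<in> topspace Y" using a \<Phi>s[OF c] by blast
    show "h (3 * u x - 1, g0 x) = a" if "u x = 2/3" for x
    proof -
      have "3 * u x - 1 = 1" using that by simp
      then show ?thesis by (simp only: h1)
    qed
    show "g0 x = (if u x \<le> 2/3 then h (3 * u x - 1, g0 x) else a)" if "u x = 1/3" for x
    proof -
      have "3 * u x - 1 = 0" "u x \<le> 2/3" using that by simp_all
      then show ?thesis by (simp only: h0 if_True)
    qed
  qed simp_all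
  have "le (f z) (f1 z) \<and> g1 z \<in> \<Phi> (f1 z)" if z: "z \<in> topspace Z" for z
  proof (cases "1/3 \<le> u z")
    case True
    then have "z \<in> N" using z by (auto simp: N_def)
    then show ?thesis using True NW g1c by (auto simp: f1_def W_def U_def)
  next
    case False
    then show ?thesis using fg0[of z] z by (auto simp: f1_def g1_def M_def)
  qed
  moreover have "f1 ` B \<subseteq> D" if BD: "(B,D) \<in> \<B>" for B D
  proof
    fix w assume "w \<in> f1 ` B"
    then obtain z where z: "z \<in> B" "w = f1 z" by auto
    then have zZ: "z \<in> topspace Z" using B[OF BD] closedin_subset by blast
    show "w \<in> D"
    proof (cases "1/3 \<le> u z")
      case True
      then have "z \<in> W" using NW zZ by (auto simp: N_def)
      then have "c \<in> D" using BD z by (auto simp: W_def)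
      then show ?thesis using True z by (simp add: f1_def)
    next
      case False
      moreover have "(B \<inter> M, D - {c}) \<in> \<B>'" using BD by (force simp: \<B>'_def)
      ultimately show ?thesis using B0 z zZ by (fastforce simp: f1_def M_def)
    qed
  qed
  ultimately show ?case
    by (intro exI[of _ f1] exI[of _ g1] conjI cf1 cg1) blast+
qed

section \<open>Gamma-collapses expressed through the order\<close>

lemma continuous_map_poset_top_mono:
  assumes "A \<subseteq> B"
  shows "continuous_map (poset_top A le) (poset_top B le) (\<lambda>x. x)"
  unfolding continuous_map_def topspace_poset_top
proof (intro conjI allI impI)
  fix U assume "openin (poset_top B le) U"
  then show "openin (poset_top A le) {x \<in> A. x \<in> U}"
    using assms unfolding openin_poset_top by blast
qed (use assms in blast)

lemma poset_top_cong:
  assumes "\<And>x y. x \<in> A \<Longrightarrow> y \<in> A \<Longrightarrow> le x y \<longleftrightarrow> le' x y"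
  shows "poset_top A le = poset_top A le'"
  unfolding topology_eq openin_poset_top using assms by blast

lemma t0_space_poset_top:
  assumes "reflp_on A le" "transp_on A le" "antisymp_on A le"
  shows "t0_space (poset_top A le)"
  unfolding t0_space_def topspace_poset_top
proof (intro ballI impI)
  fix x y assume xy: "x \<in> A" "y \<in> A" "x \<noteq> y"
  have U: "openin (poset_top A le) {u \<in> A. le u z}" if "z \<in> A" for z
    using assms(2) that unfolding openin_poset_top transp_on_def by blast
  have "\<not> le x y \<or> \<not> le y x"
    using assms(3) xy unfolding antisymp_on_def by blast
  then show "\<exists>U. openin (poset_top A le) U \<and> (x \<notin> U \<longleftrightarrow> y \<in> U)"
  proof
    assume "\<not> le x y"
    then show ?thesis
      using xy assms(1) unfolding reflp_on_def by (intro exI[of _ "{u \<in> A. le u y}"] conjI U) auto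
  next
    assume "\<not> le y x"
    then show ?thesis
      using xy assms(1) unfolding reflp_on_def by (intro exI[of _ "{u \<in> A. le u x}"] conjI U) auto
  qed
qed

lemma link_poset_top:
  assumes "reflp_on A le" "transp_on A le"
  shows "link (poset_top A le) x = poset_top {y \<in> A. y \<noteq> x \<and> x \<in> A \<and> (le x y \<or> le y x)} le"
proof -
  have "A \<inter> {y \<in> A. y \<noteq> x \<and> (space_le (poset_top A le) x y \<or> space_le (poset_top A le) y x)}
      = {y \<in> A. y \<noteq> x \<and> x \<in> A \<and> (le x y \<or> le y x)}"
    unfolding space_le_poset_top[OF assms(2,1)] by blast
  then show ?thesis
    unfolding link_def topspace_poset_top subtopology_poset_top[OF assms(2)] by (simp only:)
qed

lemma elementary_gamma_collapse_poset_top: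
  assumes "finite A" "reflp_on A le" "transp_on A le" "antisymp_on A le" and x: "x \<in> A"
    and "homotopically_trivial (poset_top {y \<in> A. y \<noteq> x \<and> (le x y \<or> le y x)} le)"
  shows "elementary_gamma_collapse (poset_top A le) (poset_top (A - {x}) le)"
  unfolding elementary_gamma_collapse_def topspace_poset_top
proof (intro conjI exI)
  have "A \<inter> (A - {x}) = A - {x}" by blast
  then show "poset_top (A - {x}) le = subtopology (poset_top A le) (A - {x})"
    unfolding subtopology_poset_top[OF assms(3)] by (simp only:)
  have "{y \<in> A. y \<noteq> x \<and> x \<in> A \<and> (le x y \<or> le y x)} = {y \<in> A. y \<noteq> x \<and> (le x y \<or> le y x)}"
    using x by blast
  then show "gamma_point (poset_top A le) x"
    using assms(6) x unfolding gamma_point_def link_poset_top[OF assms(2,3)] topspace_poset_top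
    by (simp only:)
qed (use assms t0_space_poset_top in blast)+

section \<open>Cubes and homotopical triviality\<close>

abbreviation cube :: "nat \<Rightarrow> (nat \<Rightarrow> real) set" where
  "cube n \<equiv> {x. (\<forall>i<n. 0 \<le> x i \<and> x i \<le> 1) \<and> (\<forall>i\<ge>n. x i = 0)}"

lemma cube_top_eq: "cube_top n = subtopology (powertop_real UNIV) (cube n)"
  by (auto simp: cube_top_def Euclidean_space_def subtopology_subtopology
      intro!: arg_cong[where f="subtopology _"])

lemma topspace_cube_top [simp]: "topspace (cube_top n) = cube n"
  by (simp add: cube_top_eq)

lemma cube_bd_eq: "cube_bd n = {x \<in> cube n. \<exists>i<n. x i = 0 \<or> x i = 1}"
  by (simp add: cube_bd_def)

abbreviation cball_n :: "nat \<Rightarrow> (nat \<Rightarrow> real) set" where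
  "cball_n n \<equiv> {x. (\<Sum>i<n. (x i)\<^sup>2) \<le> 1 \<and> (\<forall>i\<ge>n. x i = 0)}"

lemma ball_top_eq: "ball_top n = subtopology (powertop_real UNIV) (cball_n n)"
  by (auto simp: ball_top_def Euclidean_space_def subtopology_subtopology
      intro!: arg_cong[where f="subtopology _"])

lemma topspace_ball_top [simp]: "topspace (ball_top n) = cball_n n"
  by (simp add: ball_top_eq)

lemma ball_bd_eq: "ball_bd n = {x. (\<Sum>i<n. (x i)\<^sup>2) = 1 \<and> (\<forall>i\<ge>n. x i = 0)}"
  by (auto simp: ball_bd_def topspace_Euclidean_space)

lemma continuous_map_into_powertop_sub:
  "continuous_map T (subtopology (powertop_real UNIV) S) g \<longleftrightarrow>
     (\<forall>i. continuous_map T euclideanreal (\<lambda>z. g z i)) \<and> g \<in> topspace T \<rightarrow> S"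
  by (simp add: continuous_map_in_subtopology continuous_map_componentwise_UNIV)

lemma continuous_map_powertop_proj:
  "continuous_map (subtopology (powertop_real UNIV) S) euclideanreal (\<lambda>z. z i)"
  by (intro continuous_map_from_subtopology continuous_map_product_projection) auto

lemma Hausdorff_powertop_sub: "Hausdorff_space (subtopology (powertop_real UNIV) S)"
  by (simp add: Hausdorff_space_subtopology Hausdorff_space_product_topology)

lemma compactin_powertop_box:
  fixes n :: nat and a b :: real
  shows "compactin (powertop_real UNIV) {x. (\<forall>i<n. a \<le> x i \<and> x i \<le> b) \<and> (\<forall>i\<ge>n. x i = 0)}"
proof -
  have "compactin (powertop_real UNIV) (Pi\<^sub>E UNIV (\<lambda>i. if i < n then {a..b} else {0}))"
    by (subst compactin_PiE) auto
  also have "Pi\<^sub>E UNIV (\<lambda>i. if i < n then {a..b} else {0})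
      = {x. (\<forall>i<n. a \<le> x i \<and> x i \<le> b) \<and> (\<forall>i\<ge>n. x i = 0)}"
  proof -
    have "x i \<in> (if i < n then {a..b} else {0}) \<longleftrightarrow>
        (i < n \<longrightarrow> a \<le> x i \<and> x i \<le> b) \<and> (n \<le> i \<longrightarrow> x i = 0)" for x :: "nat \<Rightarrow> real" and i
      by auto
    then show ?thesis unfolding PiE_UNIV_domain Pi_def by blast
  qed
  finally show ?thesis .
qed

lemma compact_space_cube_top: "compact_space (cube_top n)"
  by (simp add: cube_top_eq compact_space_subtopology compactin_powertop_box)

lemma compact_space_ball_top: "compact_space (ball_top n)"
proof -
  let ?b = "{x::nat\<Rightarrow>real. (\<forall>i<n. -1 \<le> x i \<and> x i \<le> 1) \<and> (\<forall>i\<ge>n. x i = 0)}"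
  have "closedin (powertop_real UNIV) {x \<in> topspace (powertop_real UNIV). (\<Sum>i<n. (x i)\<^sup>2) \<in> {..1}}"
  proof (rule closedin_continuous_map_preimage)
    show "continuous_map (powertop_real UNIV) euclideanreal (\<lambda>x. \<Sum>i<n. (x i)\<^sup>2)"
      by (intro continuous_map_sum continuous_map_real_pow continuous_map_product_projection) auto
  qed simp
  moreover have "cball_n n = {x \<in> topspace (powertop_real UNIV). (\<Sum>i<n. (x i)\<^sup>2) \<in> {..1}} \<inter> ?b"
  proof -
    have "-1 \<le> x i \<and> x i \<le> 1" if "(\<Sum>i<n. (x i)\<^sup>2) \<le> 1" "i < n" for x :: "nat \<Rightarrow> real" and i
    proof -
      have "(x i)\<^sup>2 \<le> (\<Sum>i<n. (x i)\<^sup>2)"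
        using that by (intro member_le_sum) auto
      then have "\<bar>x i\<bar> \<le> 1" using that abs_square_le_1[of "x i"] by linarith
      then show ?thesis by linarith
    qed
    then show ?thesis by auto
  qed
  ultimately show ?thesis
    using compactin_powertop_box[of n "-1" 1]
    by (simp add: ball_top_eq compact_space_subtopology closed_Int_compactin)
qed

text \<open>Twice the distance from the centre of the cube in the maximum norm.\<close>

primrec cube_norm :: "nat \<Rightarrow> (nat \<Rightarrow> real) \<Rightarrow> real" where
  "cube_norm 0 x = 0"
| "cube_norm (Suc n) x = max (cube_norm n x) \<bar>2 * x n - 1\<bar>"

lemma cube_norm_ge: "i < n \<Longrightarrow> \<bar>2 * x i - 1\<bar> \<le> cube_norm n x"
  by (induction n) (auto simp: less_Suc_eq max_def)

lemma cube_norm_attained: "0 < cube_norm n x \<Longrightarrow> \<exists>i<n. \<bar>2 * x i - 1\<bar> = cube_norm n x"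
  by (induction n) (auto simp: less_Suc_eq max_def split: if_splits)

lemma cube_norm_le:
  assumes "\<And>i. i < n \<Longrightarrow> 0 \<le> x i \<and> x i \<le> 1"
  shows "cube_norm n x \<le> 1"
  using assms by (induction n) (auto simp: abs_le_iff)

lemma cube_norm_le_1: "x \<in> cube n \<Longrightarrow> cube_norm n x \<le> 1"
  by (rule cube_norm_le) simp

lemma cube_norm_bd: "x \<in> cube_bd n \<Longrightarrow> cube_norm n x = 1"
proof -
  assume x: "x \<in> cube_bd n"
  then obtain i where "i < n" "x i = 0 \<or> x i = 1" by (auto simp: cube_bd_eq)
  then have "1 \<le> cube_norm n x" using cube_norm_ge[of i n x] by auto
  then show ?thesis using cube_norm_le_1[of x n] x by (auto simp: cube_bd_eq)
qed

lemma continuous_map_cube_norm: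
  assumes "\<And>i. continuous_map T euclideanreal (\<lambda>z. g z i)"
  shows "continuous_map T euclideanreal (\<lambda>z. cube_norm n (g z))"
  by (induction n) (auto intro!: continuous_intros assms continuous_map_real_max)

lemma continuous_map_cube_norm_cube_top: "continuous_map (cube_top m) euclideanreal (cube_norm n)"
  by (rule continuous_map_cube_norm[where g="\<lambda>z. z"])
     (unfold cube_top_eq, rule continuous_map_powertop_proj)

text \<open>Radial projection from the centre of the cube to its boundary. Coordinates from
  \<open>n\<close> on are set to 0, so the value is again a point of \<open>cube n\<close>.\<close>

definition cube_radial :: "nat \<Rightarrow> (nat \<Rightarrow> real) \<Rightarrow> nat \<Rightarrow> real" where
  "cube_radial n z = (\<lambda>i. if i < n then 1/2 + (z i - 1/2) / cube_norm n z else 0)"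

lemma cube_radial_in_bd:
  assumes "0 < cube_norm n z"
  shows "cube_radial n z \<in> cube_bd n"
proof -
  have *: "2 * cube_radial n z i - 1 = (2 * z i - 1) / cube_norm n z" if "i < n" for i
    using that by (simp add: cube_radial_def diff_divide_distrib)
  have "0 \<le> cube_radial n z i \<and> cube_radial n z i \<le> 1" if "i < n" for i
  proof -
    have "\<bar>2 * cube_radial n z i - 1\<bar> \<le> 1"
      using cube_norm_ge[OF that, of z] assms by (simp add: *[OF that])
    then show ?thesis by linarith
  qed
  moreover obtain i where i: "i < n" "\<bar>2 * z i - 1\<bar> = cube_norm n z"
    using cube_norm_attained[OF assms] by auto
  then have "\<bar>2 * cube_radial n z i - 1\<bar> = 1" using assms by (simp add: *)
  then have "cube_radial n z i = 0 \<or> cube_radial n z i = 1" by linarith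
  ultimately show ?thesis using i by (auto simp: cube_bd_eq cube_radial_def)
qed

lemma cube_radial_bd: "z \<in> cube_bd n \<Longrightarrow> cube_radial n z = z"
  using cube_norm_bd[of z n] by (auto simp: cube_radial_def cube_bd_eq)

lemma extend_nullhomotopic_over_cube:
  assumes hom: "homotopic_with (\<lambda>_. True) (subtopology (cube_top n) (cube_bd n)) X F (\<lambda>_. a)"
    and a: "a \<in> topspace X"
  obtains E where "continuous_map (cube_top n) X E" "\<And>z. z \<in> cube_bd n \<Longrightarrow> E z = F z"
proof -
  let ?B = "subtopology (cube_top n) (cube_bd n)"
  obtain H where H: "continuous_map (prod_topology (top_of_set {0..1::real}) ?B) X H"
    and H0: "\<And>z. H (0, z) = F z" and H1: "\<And>z. H (1, z) = a"
    using hom by (auto simp: homotopic_with_def)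
  \<comment> \<open>The cube of half the side length is sent to \<open>a\<close>. On the rest, the
    time \<open>1 / cube_norm n z - 1\<close> decreases from 1 at norm 1/2 to 0 at norm 1, so the
    null-homotopy is run backwards towards the boundary.\<close>
  define E where "E = (\<lambda>z. if cube_norm n z \<le> 1/2 then a else H (1 / cube_norm n z - 1, cube_radial n z))"
  have contn: "continuous_map (cube_top n) euclideanreal (cube_norm n)"
    by (rule continuous_map_cube_norm_cube_top)
  show ?thesis
  proof
    show "continuous_map (cube_top n) X E"
      unfolding E_def
    proof (intro continuous_map_cases_le contn)
      let ?S = "subtopology (cube_top n) {x \<in> topspace (cube_top n). 1/2 \<le> cube_norm n x}"
      have cn: "continuous_map ?S euclideanreal (cube_norm n)"
        by (rule continuous_map_from_subtopology[OF contn])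
      have pos: "cube_norm n z \<noteq> 0" "0 < cube_norm n z" "1/2 \<le> cube_norm n z" "cube_norm n z \<le> 1"
        if "z \<in> topspace ?S" for z
        using that cube_norm_le_1[of z n] by auto
      have "continuous_map ?S (top_of_set {0..1}) (\<lambda>z. 1 / cube_norm n z - 1)"
        unfolding continuous_map_in_subtopology
      proof (intro conjI continuous_intros cn)
        show "(\<lambda>z. 1 / cube_norm n z - 1) \<in> topspace ?S \<rightarrow> {0..1}"
        proof
          fix z assume "z \<in> topspace ?S"
          from pos[OF this] show "1 / cube_norm n z - 1 \<in> {0..1}"
            by (simp add: divide_simps)
        qed
      qed (use pos in auto)
      moreover have "continuous_map ?S ?B (cube_radial n)"
        unfolding cube_top_eq subtopology_subtopology continuous_map_into_powertop_sub
      proof (intro conjI allI)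
        fix i
        have pr: "continuous_map ?S euclideanreal (\<lambda>z. z i)"
          unfolding cube_top_eq subtopology_subtopology by (rule continuous_map_powertop_proj)
        have "continuous_map ?S euclideanreal
            (\<lambda>z. if i < n then 1/2 + (z i - 1/2) / cube_norm n z else 0)"
        proof (cases "i < n")
          case True
          have "continuous_map ?S euclideanreal (\<lambda>z. 1/2 + (z i - 1/2) / cube_norm n z)"
            by (intro continuous_intros cn pr) (use pos in auto)
          then show ?thesis using True by simp
        qed simp
        then show "continuous_map (subtopology (powertop_real UNIV)
            (cube n \<inter> {x \<in> topspace (subtopology (powertop_real UNIV) (cube n)). 1/2 \<le> cube_norm n x}))
            euclideanreal (\<lambda>z. cube_radial n z i)"
          by (simp add: cube_radial_def cube_top_eq subtopology_subtopology)
      next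
        show "cube_radial n \<in> topspace (subtopology (powertop_real UNIV)
            (cube n \<inter> {x \<in> topspace (subtopology (powertop_real UNIV) (cube n)). 1/2 \<le> cube_norm n x})) \<rightarrow>
            cube n \<inter> cube_bd n"
          using cube_radial_in_bd[of n] by (force simp: cube_bd_eq)
      qed
      ultimately have "continuous_map ?S (prod_topology (top_of_set {0..1}) ?B)
          (\<lambda>z. (1 / cube_norm n z - 1, cube_radial n z))"
        by (simp add: continuous_map_pairwise o_def)
      from continuous_map_compose[OF this H]
      show "continuous_map ?S X (\<lambda>z. H (1 / cube_norm n z - 1, cube_radial n z))"
        by (simp add: o_def)
      show "a = H (1 / cube_norm n z - 1, cube_radial n z)" if "cube_norm n z = 1/2" for z
        using H1 by (simp add: that)
    qed (use a in auto)
    show "E z = F z" if "z \<in> cube_bd n" for z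
      using that by (simp add: E_def cube_norm_bd cube_radial_bd H0)
  qed
qed

text \<open>A spheroid contracts relative to the boundary once a suitable map on the boundary of the
  next cube extends over that cube, and a free null-homotopy is enough for such an extension. The
  test spaces are therefore boundaries of cubes, together with a two-point space for
  path-connectedness, all with points in one type.\<close>

lemma homotopically_trivial_if_nullhomotopic:
  fixes X :: "'b topology"
  assumes ne: "topspace X \<noteq> {}"
    and null: "\<And>(Z :: (nat \<Rightarrow> real) topology) f. normal_space Z \<Longrightarrow> continuous_map Z X f \<Longrightarrow>
                 \<exists>a. homotopic_with (\<lambda>_. True) Z X f (\<lambda>_. a)"
  shows "homotopically_trivial X"
  unfolding homotopically_trivial_def
proof (intro conjI allI impI ballI ne)
  show "path_connected_space X"
    unfolding path_connected_space_iff_path_component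
  proof (intro ballI)
    fix x y assume xy: "x \<in> topspace X" "y \<in> topspace X"
    \<comment> \<open>Two distinct points of type \<open>nat \<Rightarrow> real\<close>, serving as
      the 0-sphere.\<close>
    let ?c = "\<lambda>t::real. (\<lambda>_::nat. t)"
    let ?Z = "discrete_topology {?c 0, ?c 1}"
    have "?c 0 \<noteq> ?c 1" by (metis zero_neq_one)
    then obtain f where f: "f (?c 0) = x" "f (?c 1) = y"
      by (metis fun_upd_same fun_upd_other)
    have "continuous_map ?Z X f" using f xy by auto
    moreover have "normal_space ?Z" by (simp add: normal_space_discrete_topology)
    ultimately obtain a where "homotopic_with (\<lambda>_. True) ?Z X f (\<lambda>_. a)"
      using null by blast
    then obtain h where h: "continuous_map (prod_topology (top_of_set {0..1::real}) ?Z) X h"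
      and h0: "\<And>z. h (0, z) = f z" and h1: "\<And>z. h (1, z) = a"
      by (auto simp: homotopic_with_def)
    have "path_component_of X (f z) a" if "z \<in> {?c 0, ?c 1}" for z
    proof -
      have "pathin X (\<lambda>t. h (t, z))"
        unfolding pathin_def using that
        by (intro continuous_map_compose[OF _ h, unfolded o_def]) (simp add: continuous_map_pairwise o_def)
      then show ?thesis using h0 h1 unfolding path_component_of_def by blast
    qed
    then show "path_component_of X x y"
      using f by (metis insertCI path_component_of_sym path_component_of_trans)
  qed
next
  fix n x assume x: "x \<in> topspace X"
  have hom: "(f, \<lambda>_. x) \<in> spheroid_homotopy n X x" if "f \<in> spheroids n X x" for f
  proof -
    from that have f: "continuous_map (cube_top n) X f" and fx: "\<And>z. z \<in> cube_bd n \<Longrightarrow> f z = x"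
      by (auto simp: spheroids_def)
    let ?B = "subtopology (cube_top (Suc n)) (cube_bd (Suc n))"
    \<comment> \<open>On the boundary of the next cube this is \<open>f\<close> on the bottom face
      and \<open>x\<close> on all other faces. Over a side face the projected point lies in
      \<open>cube_bd n\<close>, where \<open>f\<close> equals \<open>x\<close>, so the two formulas
      agree at height 1/2.\<close>
    define F where "F = (\<lambda>z. if z n \<le> 1/2 then f (z(n := 0)) else x)"
    have topB: "topspace ?B = cube_bd (Suc n)"
      by (auto simp: cube_bd_eq)
    have proj: "continuous_map ?B euclideanreal (\<lambda>z. z i)" for i
      by (simp add: cube_top_eq subtopology_subtopology continuous_map_powertop_proj)
    have F0: "f (z(n := 0)) = x" if "z \<in> cube_bd (Suc n)" "z n \<noteq> 0" "z n \<noteq> 1" for z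
      using that by (intro fx) (auto simp: cube_bd_eq less_Suc_eq)
    have "continuous_map ?B X F"
      unfolding F_def
    proof (intro continuous_map_cases_le proj)
      show "continuous_map (subtopology ?B {z \<in> topspace ?B. z n \<le> 1/2}) X (\<lambda>z. f (z(n := 0)))"
      proof (rule continuous_map_from_subtopology, rule continuous_map_compose[OF _ f, unfolded o_def])
        show "continuous_map ?B (cube_top n) (\<lambda>z. z(n := 0))"
          unfolding cube_top_eq[of n] continuous_map_into_powertop_sub
        proof (intro conjI allI)
          show "continuous_map ?B euclideanreal (\<lambda>z. (z(n := 0)) i)" for i
            using proj[of i] by (cases "i = n") auto
        qed (auto simp: topB cube_bd_eq)
      qed
      show "f (z(n := 0)) = x" if "z \<in> topspace ?B" "z n = 1/2" for z
        using F0[of z] that topB by auto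
    qed (use x in auto)
    moreover have "normal_space ?B"
    proof (rule normal_space_closed_subtopology)
      show "normal_space (cube_top (Suc n))"
        by (rule compact_Hausdorff_or_regular_imp_normal_space[OF compact_space_cube_top])
           (unfold cube_top_eq, rule disjI1, rule Hausdorff_powertop_sub)
      have "continuous_map (cube_top (Suc n)) euclideanreal (cube_norm (Suc n))"
        by (rule continuous_map_cube_norm_cube_top)
      then have "closedin (cube_top (Suc n)) {z \<in> topspace (cube_top (Suc n)). cube_norm (Suc n) z \<in> {1}}"
        by (rule closedin_continuous_map_preimage) simp
      moreover have "{z \<in> topspace (cube_top (Suc n)). cube_norm (Suc n) z \<in> {1}} = cube_bd (Suc n)"
      proof (intro equalityI subsetI)
        fix z assume z: "z \<in> {z \<in> topspace (cube_top (Suc n)). cube_norm (Suc n) z \<in> {1}}"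
        then obtain i where "i < Suc n" "\<bar>2 * z i - 1\<bar> = 1"
          using cube_norm_attained[of "Suc n" z] by auto
        moreover from this(2) have "z i = 0 \<or> z i = 1" by linarith
        ultimately show "z \<in> cube_bd (Suc n)"
          using z unfolding cube_bd_eq by auto
      next
        fix z assume "z \<in> cube_bd (Suc n)"
        then show "z \<in> {z \<in> topspace (cube_top (Suc n)). cube_norm (Suc n) z \<in> {1}}"
          using cube_norm_bd[of z "Suc n"] by (auto simp: cube_bd_eq)
      qed
      ultimately show "closedin (cube_top (Suc n)) (cube_bd (Suc n))" by simp
    qed
    ultimately obtain a where a: "homotopic_with (\<lambda>_. True) ?B X F (\<lambda>_. a)"
      using null by blast
    have "(\<lambda>_. 0) \<in> topspace ?B" by (auto simp: cube_bd_eq)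
    with homotopic_with_imp_continuous_maps[OF a] have "a \<in> topspace X"
      unfolding continuous_map_def by blast
    then obtain E where E: "continuous_map (cube_top (Suc n)) X E"
      and EF: "\<And>z. z \<in> cube_bd (Suc n) \<Longrightarrow> E z = F z"
      using extend_nullhomotopic_over_cube[OF a] by blast
    have "homotopic_with (\<lambda>k. k ` cube_bd n \<subseteq> {x}) (cube_top n) X f (\<lambda>_. x)"
    proof (subst homotopic_with)
      show "h ` cube_bd n \<subseteq> {x} \<longleftrightarrow> k ` cube_bd n \<subseteq> {x}"
        if "\<And>z. z \<in> topspace (cube_top n) \<Longrightarrow> h z = k z" for h k :: "(nat \<Rightarrow> real) \<Rightarrow> 'b"
        using that by (force simp: cube_bd_eq)
      let ?P = "prod_topology (top_of_set {0..1::real}) (cube_top n)"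
      \<comment> \<open>The last coordinate of the cube becomes the time. Bottom and top faces give
        \<open>f\<close> and the constant, and the side faces keep the boundary at \<open>x\<close>
        throughout.\<close>
      let ?h = "\<lambda>p. E ((snd p)(n := fst p))"
      have "continuous_map ?P (cube_top (Suc n)) (\<lambda>p. (snd p)(n := fst p))"
        unfolding cube_top_eq[of "Suc n"] continuous_map_into_powertop_sub
      proof (intro conjI allI)
        fix i
        have "continuous_map ?P euclideanreal (\<lambda>p. snd p i)"
          by (rule continuous_map_compose[OF continuous_map_snd, unfolded o_def])
             (simp add: cube_top_eq continuous_map_powertop_proj)
        moreover have "continuous_map ?P euclideanreal fst"
          using continuous_map_fst[of "top_of_set {0..1::real}"] continuous_map_into_fulltopology by blast
        ultimately show "continuous_map ?P euclideanreal (\<lambda>p. ((snd p)(n := fst p)) i)"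
          by (cases "i = n") auto
      qed auto
      then have "continuous_map ?P X ?h"
        by (rule continuous_map_compose[OF _ E, unfolded o_def])
      moreover have "?h (0, z) = f z" if "z \<in> topspace (cube_top n)" for z
      proof -
        have zn: "z n = 0" using that by auto
        then have "z(n := 0) = z" by auto
        moreover have "z \<in> cube_bd (Suc n)"
          using that zn by (auto simp: cube_bd_eq less_Suc_eq)
        ultimately show ?thesis using EF[of z] zn by (simp add: F_def)
      qed
      moreover have "?h (1, z) = x" if "z \<in> topspace (cube_top n)" for z
      proof -
        have "z(n := 1) \<in> cube (Suc n)" using that by auto
        then have "z(n := 1) \<in> cube_bd (Suc n)" unfolding cube_bd_eq by force
        from EF[OF this] show ?thesis by (simp add: F_def)
      qed
      moreover have "?h (t, z) = x" if "t \<in> {0..1}" "z \<in> cube_bd n" for t z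
      proof -
        have zn: "z n = 0" "z(n := 0) = z" using that by (auto simp: cube_bd_eq)
        have "z(n := t) \<in> cube_bd (Suc n)" using that by (auto simp: cube_bd_eq less_Suc_eq)
        then show ?thesis using EF[of "z(n := t)"] fx[OF that(2)] zn by (simp add: F_def)
      qed
      ultimately show "\<exists>h. continuous_map ?P X h \<and>
          (\<forall>z\<in>topspace (cube_top n). h (0, z) = f z) \<and>
          (\<forall>z\<in>topspace (cube_top n). h (1, z) = x) \<and>
          (\<forall>t\<in>{0..1}. (\<lambda>z. h (t, z)) ` cube_bd n \<subseteq> {x})"
        by (intro exI[of _ ?h]) auto
    qed
    then show ?thesis by (simp add: spheroid_homotopy_def)
  qed
  have const: "(\<lambda>_. x) \<in> spheroids n X x" using x by (auto simp: spheroids_def)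
  have "homotopy_group_set n X x = {spheroid_homotopy n X x `` {\<lambda>_. x}}"
  proof -
    have "spheroid_homotopy n X x `` {f} = spheroid_homotopy n X x `` {\<lambda>_. x}"
      if "f \<in> spheroids n X x" for f
      by (rule equiv_class_eq[OF equiv_spheroid_homotopy hom[OF that]])
    then show ?thesis using const unfolding homotopy_group_set_def quotient_def by blast
  qed
  then show "is_singleton (homotopy_group_set n X x)" by (simp add: is_singleton_def)
qed

lemma homotopically_trivial_contractible:
  assumes "topspace X \<noteq> {}" "contractible_space X"
  shows "homotopically_trivial X"
  by (rule homotopically_trivial_if_nullhomotopic)
     (use assms nullhomotopic_into_contractible_space in blast)+

section \<open>Balls attached along a homotopy equivalence\<close>

lemma continuous_map_homotopy_compose:
  assumes "continuous_map (prod_topology (top_of_set {0..1::real}) X) Y h"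
    and "continuous_map T euclideanreal t" "\<And>z. z \<in> topspace T \<Longrightarrow> t z \<in> {0..1}"
    and "continuous_map T X s"
  shows "continuous_map T Y (\<lambda>z. h (t z, s z))"
proof -
  have "continuous_map T (top_of_set {0..1}) t"
    using assms by (auto simp: continuous_map_in_subtopology)
  then have "continuous_map T (prod_topology (top_of_set {0..1}) X) (\<lambda>z. (t z, s z))"
    using assms by (simp add: continuous_map_pairwise o_def)
  from continuous_map_compose[OF this assms(1)] show ?thesis by (simp add: o_def)
qed

section \<open>Polar coordinates on the ball\<close>

definition ball_norm :: "nat \<Rightarrow> (nat \<Rightarrow> real) \<Rightarrow> real" where
  "ball_norm n x = sqrt (\<Sum>i<n. (x i)\<^sup>2)"

text \<open>At the origin division by zero yields the zero vector; continuity is only claimed where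
  the norm is positive.\<close>

definition ball_dir :: "nat \<Rightarrow> (nat \<Rightarrow> real) \<Rightarrow> nat \<Rightarrow> real" where
  "ball_dir n x = (\<lambda>i. x i / ball_norm n x)"

lemma ball_norm_nonneg: "0 \<le> ball_norm n x"
  by (simp add: ball_norm_def sum_nonneg)

lemma mem_cball_n: "x \<in> cball_n n \<longleftrightarrow> ball_norm n x \<le> 1 \<and> (\<forall>i\<ge>n. x i = 0)"
  by (simp add: ball_norm_def)

lemma mem_ball_bd: "x \<in> ball_bd n \<longleftrightarrow> ball_norm n x = 1 \<and> (\<forall>i\<ge>n. x i = 0)"
  by (simp add: ball_norm_def ball_bd_eq)

lemma ball_norm_scale: "ball_norm n (\<lambda>i. c * x i) = \<bar>c\<bar> * ball_norm n x"
  by (simp add: ball_norm_def power_mult_distrib real_sqrt_mult flip: sum_distrib_left)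

lemma ball_dir_in_bd:
  assumes "0 < ball_norm n x" "\<forall>i\<ge>n. x i = 0"
  shows "ball_dir n x \<in> ball_bd n"
  using ball_norm_scale[of n "1 / ball_norm n x" x] assms
  by (simp add: mem_ball_bd ball_dir_def)

lemma ball_dir_scale: "0 < c \<Longrightarrow> ball_dir n (\<lambda>i. c * x i) = ball_dir n x"
  by (simp add: ball_dir_def ball_norm_scale)

lemma ball_dir_bd: "x \<in> ball_bd n \<Longrightarrow> ball_dir n x = x"
  by (simp add: ball_dir_def mem_ball_bd)

text \<open>This matches the branches of the piecewise maps below: on the sphere of radius
  \<open>1 / c\<close>, where a stretched inner ball meets its collar, stretching by
  \<open>c\<close> and taking the direction agree.\<close>

lemma ball_dir_eq_scale: "ball_norm n x = 1 / c \<Longrightarrow> ball_dir n x = (\<lambda>i. c * x i)"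
  by (simp add: ball_dir_def mult.commute)

lemma sphere_top_eq:
  "subtopology (Euclidean_space n) (ball_bd n) = subtopology (powertop_real UNIV) (ball_bd n)"
  by (auto simp: Euclidean_space_def subtopology_subtopology ball_bd_eq
      intro!: arg_cong[where f="subtopology _"])

lemma continuous_map_ball_coord:
  "continuous_map T (ball_top n) f \<Longrightarrow> continuous_map T euclideanreal (\<lambda>z. f z i)"
  by (simp add: ball_top_eq continuous_map_into_powertop_sub)

lemma continuous_map_ball_norm:
  assumes "continuous_map T (ball_top n) f"
  shows "continuous_map T euclideanreal (\<lambda>z. ball_norm n (f z))"
  unfolding ball_norm_def
  by (intro continuous_map_sqrt continuous_map_sum continuous_map_real_pow
      continuous_map_ball_coord[OF assms]) auto

lemma continuous_map_ball_dir:
  assumes f: "continuous_map T (ball_top n) f"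
    and pos: "\<And>z. z \<in> topspace T \<Longrightarrow> 0 < ball_norm n (f z)"
  shows "continuous_map T (subtopology (Euclidean_space n) (ball_bd n)) (\<lambda>z. ball_dir n (f z))"
  unfolding sphere_top_eq continuous_map_into_powertop_sub
proof (intro conjI allI)
  show "continuous_map T euclideanreal (\<lambda>z. ball_dir n (f z) i)" for i
    unfolding ball_dir_def
    by (intro continuous_map_real_divide continuous_map_ball_coord[OF f] continuous_map_ball_norm[OF f])
       (use pos in force)
  show "(\<lambda>z. ball_dir n (f z)) \<in> topspace T \<rightarrow> ball_bd n"
    using f pos by (auto intro!: ball_dir_in_bd simp: continuous_map_def Pi_iff)
qed

lemma continuous_map_ball_scale:
  assumes f: "continuous_map T (ball_top n) f" and c: "continuous_map T euclideanreal c"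
    and le: "\<And>z. z \<in> topspace T \<Longrightarrow> \<bar>c z\<bar> * ball_norm n (f z) \<le> 1"
  shows "continuous_map T (ball_top n) (\<lambda>z i. c z * f z i)"
  unfolding ball_top_eq continuous_map_into_powertop_sub
proof (intro conjI allI)
  show "continuous_map T euclideanreal (\<lambda>z. c z * f z i)" for i
    by (intro continuous_map_real_mult c continuous_map_ball_coord[OF f])
  show "(\<lambda>z i. c z * f z i) \<in> topspace T \<rightarrow> cball_n n"
    using f le by (auto simp: mem_cball_n ball_norm_scale continuous_map_def Pi_iff
        simp del: mem_Collect_eq)
qed

lemma ball_bd_subset: "ball_bd n \<subseteq> cball_n n"
  by (auto simp: ball_bd_eq)

lemma continuous_map_sphere_ball:
  "continuous_map (subtopology (Euclidean_space n) (ball_bd n)) (ball_top n) (\<lambda>x. x)"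
  unfolding sphere_top_eq ball_top_eq continuous_map_into_powertop_sub
  using continuous_map_powertop_proj ball_bd_subset by fastforce

lemma topspace_sphere [simp]: "topspace (subtopology (Euclidean_space n) (ball_bd n)) = ball_bd n"
  by (simp add: sphere_top_eq)

lemma contractible_ball_top: "contractible_space (ball_top n)"
  unfolding contractible_space_def
proof (intro exI)
  let ?P = "prod_topology (top_of_set {0..1::real}) (ball_top n)"
  have c: "continuous_map ?P euclideanreal fst"
    using continuous_map_fst[of "top_of_set {0..1::real}"] continuous_map_into_fulltopology by blast
  have "continuous_map ?P (ball_top n) (\<lambda>p i. (1 - fst p) * snd p i)"
  proof (rule continuous_map_ball_scale[OF continuous_map_snd])
    fix z assume "z \<in> topspace ?P"
    then have "0 \<le> 1 - fst z" "1 - fst z \<le> 1" "ball_norm n (snd z) \<le> 1"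
      using mem_cball_n by (auto simp: mem_Times_iff)
    then show "\<bar>1 - fst z\<bar> * ball_norm n (snd z) \<le> 1"
      using mult_le_one[of "1 - fst z" "ball_norm n (snd z)"] ball_norm_nonneg by auto
  qed (intro continuous_intros c)
  then show "homotopic_with (\<lambda>_. True) (ball_top n) (ball_top n) id (\<lambda>_ _. 0)"
    unfolding homotopic_with_def
    by (intro exI[of _ "\<lambda>p i. (1 - fst p) * snd p i"]) auto
qed

text \<open>Multiplying \<open>\<phi>\<close> by the interval gives a continuous surjection from a
  compact space onto a Hausdorff space, hence again a quotient map, so homotopies constant on fibres
  descend.\<close>

lemma quotient_homotopy_lift:
  assumes \<phi>: "continuous_map D C \<phi>" "\<phi> ` topspace D = topspace C"
    and D: "compact_space D" and C: "Hausdorff_space C"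
    and H: "continuous_map (prod_topology (top_of_set {0..1::real}) D) Y H"
    and fib: "\<And>t x x'. t \<in> {0..1} \<Longrightarrow> x \<in> topspace D \<Longrightarrow> x' \<in> topspace D \<Longrightarrow> \<phi> x = \<phi> x' \<Longrightarrow> H (t, x) = H (t, x')"
  obtains G where "continuous_map (prod_topology (top_of_set {0..1::real}) C) Y G"
    "\<And>t x. t \<in> {0..1} \<Longrightarrow> x \<in> topspace D \<Longrightarrow> G (t, \<phi> x) = H (t, x)"
proof -
  let ?I = "top_of_set {0..1::real}"
  let ?q = "\<lambda>p. (fst p, \<phi> (snd p))"
  have I: "compact_space ?I"
    using compact_Icc by (simp add: compact_space_subtopology)
  have q: "quotient_map (prod_topology ?I D) (prod_topology ?I C) ?q"
  proof (rule continuous_imp_quotient_map)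
    show "continuous_map (prod_topology ?I D) (prod_topology ?I C) ?q"
      unfolding continuous_map_pairwise o_def fst_conv snd_conv
      by (intro conjI continuous_map_fst continuous_map_compose[OF continuous_map_snd \<phi>(1), unfolded o_def])
    show "?q ` topspace (prod_topology ?I D) = topspace (prod_topology ?I C)"
      unfolding topspace_prod_topology \<phi>(2)[symmetric] by force
    show "compact_space (prod_topology ?I D)"
      unfolding compact_space_prod_topology using I D by blast
    show "Hausdorff_space (prod_topology ?I C)"
      unfolding Hausdorff_space_prod_topology
      by (intro disjI2 conjI C Hausdorff_space_subtopology Hausdorff_space_euclidean)
  qed
  have Hq: "H p = H p'"
    if p: "p \<in> topspace (prod_topology ?I D)" "p' \<in> topspace (prod_topology ?I D)" "?q p = ?q p'" for p p'
  proof (cases p; cases p')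
    fix t x t' x' assume "p = (t, x)" "p' = (t', x')"
    then show ?thesis using p fib[of t x x'] by simp
  qed
  obtain G where G: "continuous_map (prod_topology ?I C) Y G"
    and GH: "\<And>p. p \<in> topspace (prod_topology ?I D) \<Longrightarrow> G (?q p) = H p"
    by (rule quotient_map_lift_exists[OF q H]) (erule (2) Hq, erule that, blast)
  show ?thesis
  proof
    show "G (t, \<phi> x) = H (t, x)" if "t \<in> {0..1}" "x \<in> topspace D" for t x
      using GH[of "(t, x)"] that by simp
  qed (rule G)
qed

text \<open>Here \<open>C\<close> is the ball \<open>D\<close> with its boundary sphere glued along \<open>\<phi>\<close>. Let \<open>k\<close> be a homotopy inverse
  of \<open>\<phi>\<close> on the sphere, with homotopies \<open>\<alpha>\<close> from \<open>k \<circ> \<phi>\<close> and \<open>\<beta>\<close> from \<open>\<phi> \<circ> k\<close> to the identity. We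
  define \<open>a: C \<rightarrow> D\<close> as \<open>k\<close> on the boundary with \<open>\<alpha>\<close> backwards on a collar, and \<open>b: D \<rightarrow> C\<close> as \<open>\<phi>\<close> with \<open>\<beta>\<close>
  backwards followed by \<open>\<phi> \<circ> \<alpha>\<close> on a collar. In \<open>b \<circ> a\<close> the homotopy \<open>H1\<close> cancels \<open>\<phi> \<circ> \<alpha>\<close> against its
  reverse, and \<open>H2\<close> then undoes \<open>\<beta>\<close>. So \<open>C\<close> is dominated by \<open>D\<close>, and no coherence
  between \<open>\<alpha>\<close> and \<open>\<beta>\<close> is needed.\<close>

lemma contractible_ball_adjunction:
  fixes C :: "'a topology" and \<phi> :: "(nat \<Rightarrow> real) \<Rightarrow> 'a"
  assumes \<phi>: "continuous_map (ball_top n) C \<phi>" "\<phi> ` topspace (ball_top n) = topspace C"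
    and C: "Hausdorff_space C"
    and fib: "\<And>x x'. x \<in> topspace (ball_top n) \<Longrightarrow> x' \<in> topspace (ball_top n) \<Longrightarrow> \<phi> x = \<phi> x' \<Longrightarrow>
              x = x' \<or> x \<in> ball_bd n \<and> x' \<in> ball_bd n"
    and he: "homotopy_equivalence_map (subtopology (Euclidean_space n) (ball_bd n))
              (subtopology C (\<phi> ` ball_bd n)) \<phi>"
  shows "contractible_space C"
proof -
  let ?I = "top_of_set {0..1::real}"
  let ?D = "ball_top n"
  let ?S = "subtopology (Euclidean_space n) (ball_bd n)"
  let ?A = "subtopology C (\<phi> ` ball_bd n)"
  let ?P = "prod_topology ?I ?D"
  let ?r = "ball_norm n" and ?s = "ball_dir n"
  obtain k where \<phi>S: "continuous_map ?S ?A \<phi>" and k: "continuous_map ?A ?S k"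
    and h1: "homotopic_with (\<lambda>_. True) ?S ?S (k \<circ> \<phi>) id"
    and h2: "homotopic_with (\<lambda>_. True) ?A ?A (\<phi> \<circ> k) id"
    using he unfolding homotopy_equivalence_map_def by blast
  obtain \<alpha> where \<alpha>: "continuous_map (prod_topology ?I ?S) ?S \<alpha>"
    and "\<forall>s. \<alpha> (0, s) = (k \<circ> \<phi>) s" and "\<forall>s. \<alpha> (1, s) = id s"
    using h1 unfolding homotopic_with_def by blast
  then have \<alpha>0: "\<alpha> (0, s) = k (\<phi> s)" and \<alpha>1: "\<alpha> (1, s) = s" for s
    by (simp_all only: o_apply id_apply)
  obtain \<beta> where \<beta>: "continuous_map (prod_topology ?I ?A) ?A \<beta>"
    and "\<forall>a. \<beta> (0, a) = (\<phi> \<circ> k) a" and "\<forall>a. \<beta> (1, a) = id a"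
    using h2 unfolding homotopic_with_def by blast
  then have \<beta>0: "\<beta> (0, a) = \<phi> (k a)" and \<beta>1: "\<beta> (1, a) = a" for a
    by (simp_all only: o_apply id_apply)
  have \<alpha>S: "\<alpha> (t, s) \<in> ball_bd n" if "t \<in> {0..1}" "s \<in> ball_bd n" for t s
    using continuous_map_funspace[OF \<alpha>] that unfolding topspace_prod_topology topspace_sphere
    by auto
  note \<alpha>D = continuous_map_compose[OF \<alpha> continuous_map_sphere_ball, unfolded o_def]
  note \<beta>C = continuous_map_into_fulltopology[OF \<beta>]
  note \<alpha>C = continuous_map_compose[OF \<alpha>D \<phi>(1), unfolded o_def]
  have rD: "?r x \<le> 1" if "x \<in> topspace ?D" for x
    using that mem_cball_n by auto
  have dirD: "?s x \<in> ball_bd n" if "x \<in> topspace ?D" "0 < ?r x" for x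
    by (rule ball_dir_in_bd) (use that in simp_all)
  have idD: "continuous_map ?D ?D (\<lambda>x. x)" by simp
  have rDc: "continuous_map ?D euclideanreal ?r"
    by (rule continuous_map_ball_norm) simp
  have cfst: "continuous_map ?P euclideanreal fst"
    using continuous_map_fst[of ?I] continuous_map_into_fulltopology by blast
  have rPc: "continuous_map ?P euclideanreal (\<lambda>p. ?r (snd p))"
    by (rule continuous_map_ball_norm[OF continuous_map_snd])
  have rDc': "continuous_map (subtopology ?D U) euclideanreal ?r" for U
    by (rule continuous_map_from_subtopology[OF rDc])
  have rPc': "continuous_map (subtopology ?P U) euclideanreal (\<lambda>p. ?r (snd p))" for U
    by (rule continuous_map_from_subtopology[OF rPc])
  have cfst': "continuous_map (subtopology ?P U) euclideanreal fst" for U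
    by (rule continuous_map_from_subtopology[OF cfst])
  have dirc: "continuous_map (subtopology ?D U) ?S ?s"
    if "\<And>x. x \<in> U \<Longrightarrow> 0 < ?r x" for U
    by (rule continuous_map_ball_dir[OF continuous_map_from_subtopology[OF idD]]) (use that in simp)
  have dirP: "continuous_map (subtopology ?P U) ?S (\<lambda>p. ?s (snd p))"
    if "\<And>p. p \<in> U \<Longrightarrow> 0 < ?r (snd p)" for U
    by (rule continuous_map_ball_dir[OF continuous_map_from_subtopology[OF continuous_map_snd]])
       (use that in simp)
  note \<phi>dirc = continuous_map_compose[OF dirc \<phi>S, unfolded o_def]
  note \<phi>dirP = continuous_map_compose[OF dirP \<phi>S, unfolded o_def]
  have scalec: "continuous_map (subtopology ?D U) C (\<lambda>x. \<phi> (\<lambda>i. c * x i))"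
    if "\<And>x. x \<in> U \<Longrightarrow> \<bar>c\<bar> * ?r x \<le> 1" for c U
    by (rule continuous_map_compose[OF _ \<phi>(1), unfolded o_def],
        rule continuous_map_ball_scale[OF continuous_map_from_subtopology[OF idD]]) (use that in auto)
  have scaleP: "continuous_map (subtopology ?P U) C (\<lambda>p. \<phi> (\<lambda>i. c p * snd p i))"
    if "continuous_map (subtopology ?P U) euclideanreal c"
      "\<And>p. p \<in> U \<Longrightarrow> \<bar>c p\<bar> * ?r (snd p) \<le> 1" for c U
    by (rule continuous_map_compose[OF _ \<phi>(1), unfolded o_def],
        rule continuous_map_ball_scale[OF continuous_map_from_subtopology[OF continuous_map_snd] that(1)])
       (use that(2) in simp)
  \<comment> \<open>The ball of radius 1/2 is stretched to the whole ball, and the collar runs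
    \<alpha> from time 1 down to time 0. On the sphere this ends in \<open>k (\<phi> x)\<close>,
    which depends only on \<open>\<phi> x\<close>, so the map descends to \<open>C\<close>.\<close>
  define a' where "a' = (\<lambda>x. if ?r x \<le> 1/2 then (\<lambda>i. 2 * x i) else \<alpha> (2 - 2 * ?r x, ?s x))"
  have ca': "continuous_map ?D ?D a'"
    unfolding a'_def
  proof (intro continuous_map_cases_le rDc)
    show "continuous_map (subtopology ?D {x \<in> topspace ?D. ?r x \<le> 1/2}) ?D (\<lambda>x i. 2 * x i)"
      by (rule continuous_map_ball_scale) (auto intro: continuous_map_from_subtopology)
    show "continuous_map (subtopology ?D {x \<in> topspace ?D. 1/2 \<le> ?r x}) ?D
        (\<lambda>x. \<alpha> (2 - 2 * ?r x, ?s x))"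
    proof (rule continuous_map_homotopy_compose[OF \<alpha>D])
      show "continuous_map (subtopology ?D {x \<in> topspace ?D. 1/2 \<le> ?r x}) euclideanreal (\<lambda>x. 2 - 2 * ?r x)"
        by (intro continuous_intros rDc')
      show "continuous_map (subtopology ?D {x \<in> topspace ?D. 1/2 \<le> ?r x}) ?S ?s"
        by (rule dirc) simp
      show "2 - 2 * ?r x \<in> {0..1}" if "x \<in> topspace (subtopology ?D {x \<in> topspace ?D. 1/2 \<le> ?r x})" for x
        using that rD[of x] by auto
    qed
    show "(\<lambda>i. 2 * x i) = \<alpha> (2 - 2 * ?r x, ?s x)" if "?r x = 1/2" for x
      unfolding ball_dir_eq_scale[OF that] unfolding that by (simp add: \<alpha>1)
  qed auto
  have a'S: "a' x = k (\<phi> x)" if "x \<in> ball_bd n" for x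
    using that by (simp add: a'_def mem_ball_bd ball_dir_bd \<alpha>0)
  have "quotient_map ?D C \<phi>"
    by (rule continuous_imp_quotient_map) (use \<phi> C in \<open>auto simp: compact_space_ball_top\<close>)
  moreover have "a' x = a' x'" if "x \<in> topspace ?D" "x' \<in> topspace ?D" "\<phi> x = \<phi> x'" for x x'
    using fib[of x x'] that a'S by auto
  ultimately obtain a where a: "continuous_map C ?D a" and aa': "\<And>x. x \<in> topspace ?D \<Longrightarrow> a (\<phi> x) = a' x"
    using quotient_map_lift_exists[OF _ ca'] by metis
  \<comment> \<open>At radius 1/4 the time of \<beta> is 1 and the value
    \<open>\<phi> (?s y)\<close>. At radius 1/2 both collars give
    \<open>\<phi> (k (\<phi> (?s y)))\<close>. At radius 1 the time of \<alpha> is 1, so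
    \<open>b\<close> agrees with \<open>\<phi>\<close> on the sphere.\<close>
  define b where "b = (\<lambda>y. if ?r y \<le> 1/4 then \<phi> (\<lambda>i. 4 * y i)
      else if ?r y \<le> 1/2 then \<beta> (2 - 4 * ?r y, \<phi> (?s y)) else \<phi> (\<alpha> (2 * ?r y - 1, ?s y)))"
  have b: "continuous_map ?D C b"
    unfolding b_def
  proof (intro continuous_map_cases_le rDc)
    show "continuous_map (subtopology ?D {x \<in> topspace ?D. ?r x \<le> 1/4}) C (\<lambda>y. \<phi> (\<lambda>i. 4 * y i))"
      by (rule scalec) simp
    let ?T = "subtopology ?D {x \<in> topspace ?D. 1/4 \<le> ?r x}"
    show "continuous_map ?T euclideanreal ?r" by (rule rDc')
    show "continuous_map (subtopology ?T {x \<in> topspace ?T. ?r x \<le> 1/2}) C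
        (\<lambda>y. \<beta> (2 - 4 * ?r y, \<phi> (?s y)))"
      unfolding subtopology_subtopology
    proof (rule continuous_map_homotopy_compose[OF \<beta>C _ _ \<phi>dirc])
      let ?U = "{x \<in> topspace ?D. 1/4 \<le> ?r x} \<inter> {x \<in> topspace ?T. ?r x \<le> 1/2}"
      show "continuous_map (subtopology ?D ?U) euclideanreal (\<lambda>y. 2 - 4 * ?r y)"
        by (intro continuous_intros rDc')
      show "2 - 4 * ?r x \<in> {0..1}" if "x \<in> topspace (subtopology ?D ?U)" for x
        using that by auto
    qed auto
    show "continuous_map (subtopology ?T {x \<in> topspace ?T. 1/2 \<le> ?r x}) C
        (\<lambda>y. \<phi> (\<alpha> (2 * ?r y - 1, ?s y)))"
      unfolding subtopology_subtopology
    proof (rule continuous_map_homotopy_compose[OF \<alpha>C _ _ dirc])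
      let ?U = "{x \<in> topspace ?D. 1/4 \<le> ?r x} \<inter> {x \<in> topspace ?T. 1/2 \<le> ?r x}"
      show "continuous_map (subtopology ?D ?U) euclideanreal (\<lambda>y. 2 * ?r y - 1)"
        by (intro continuous_intros rDc')
      show "2 * ?r x - 1 \<in> {0..1}" if "x \<in> topspace (subtopology ?D ?U)" for x
        using that rD[of x] by auto
    qed auto
    show "\<beta> (2 - 4 * ?r x, \<phi> (?s x)) = \<phi> (\<alpha> (2 * ?r x - 1, ?s x))" if "?r x = 1/2" for x
      unfolding that by (simp add: \<alpha>0 \<beta>0)
    show "\<phi> (\<lambda>i. 4 * x i) =
        (if ?r x \<le> 1/2 then \<beta> (2 - 4 * ?r x, \<phi> (?s x)) else \<phi> (\<alpha> (2 * ?r x - 1, ?s x)))"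
      if "?r x = 1/4" for x
      unfolding ball_dir_eq_scale[OF that] unfolding that by (simp add: \<beta>1)
  qed auto
  \<comment> \<open>At time 0 this is \<open>b\<close> after \<open>a'\<close>. Since
    \<open>a'\<close> doubles radii up to 1/2, the radii 1/4 and 1/2 of \<open>b\<close> become 1/8
    and 1/4. Beyond 1/4 the time of \<alpha> first rises as \<open>4 * r - 1\<close> and then, once
    \<open>a'\<close> has reached the sphere, falls as \<open>2 - 2 * r\<close>; the smaller of the
    two is always the right one. Cutting this path off at height \<open>1 - t\<close> cancels the
    rise against the fall.\<close>
  define H1 where "H1 = (\<lambda>p. let t = fst p; x = snd p; r = ?r x in
      if r \<le> 1/8 then \<phi> (\<lambda>i. 8 * x i)
      else if r \<le> 1/4 then \<beta> (2 - 8 * r, \<phi> (?s x))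
      else \<phi> (\<alpha> (min (min (4 * r - 1) (2 - 2 * r)) (1 - t), ?s x)))"
  have cH1: "continuous_map ?P C H1"
    unfolding H1_def Let_def
  proof (intro continuous_map_cases_le rPc)
    show "continuous_map (subtopology ?P {x \<in> topspace ?P. ?r (snd x) \<le> 1/8}) C (\<lambda>p. \<phi> (\<lambda>i. 8 * snd p i))"
      by (rule scaleP) auto
    let ?T = "subtopology ?P {x \<in> topspace ?P. 1/8 \<le> ?r (snd x)}"
    show "continuous_map ?T euclideanreal (\<lambda>p. ?r (snd p))" by (rule rPc')
    show "continuous_map (subtopology ?T {x \<in> topspace ?T. ?r (snd x) \<le> 1/4}) C
        (\<lambda>p. \<beta> (2 - 8 * ?r (snd p), \<phi> (?s (snd p))))"
      unfolding subtopology_subtopology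
    proof (rule continuous_map_homotopy_compose[OF \<beta>C _ _ \<phi>dirP])
      let ?U = "{x \<in> topspace ?P. 1/8 \<le> ?r (snd x)} \<inter> {x \<in> topspace ?T. ?r (snd x) \<le> 1/4}"
      show "continuous_map (subtopology ?P ?U) euclideanreal (\<lambda>p. 2 - 8 * ?r (snd p))"
        by (intro continuous_intros rPc')
      show "2 - 8 * ?r (snd p) \<in> {0..1}" if "p \<in> topspace (subtopology ?P ?U)" for p
        using that by auto
    qed auto
    show "continuous_map (subtopology ?T {x \<in> topspace ?T. 1/4 \<le> ?r (snd x)}) C
        (\<lambda>p. \<phi> (\<alpha> (min (min (4 * ?r (snd p) - 1) (2 - 2 * ?r (snd p))) (1 - fst p), ?s (snd p))))"
      unfolding subtopology_subtopology
    proof (rule continuous_map_homotopy_compose[OF \<alpha>C _ _ dirP])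
      let ?U = "{x \<in> topspace ?P. 1/8 \<le> ?r (snd x)} \<inter> {x \<in> topspace ?T. 1/4 \<le> ?r (snd x)}"
      show "continuous_map (subtopology ?P ?U) euclideanreal
          (\<lambda>p. min (min (4 * ?r (snd p) - 1) (2 - 2 * ?r (snd p))) (1 - fst p))"
        by (intro continuous_intros continuous_map_real_min rPc' cfst')
      show "min (min (4 * ?r (snd p) - 1) (2 - 2 * ?r (snd p))) (1 - fst p) \<in> {0..1}"
        if "p \<in> topspace (subtopology ?P ?U)" for p
      proof -
        have "1/4 \<le> ?r (snd p)" "?r (snd p) \<le> 1" "0 \<le> fst p" "fst p \<le> 1"
          using that rD[of "snd p"] by auto
        then show ?thesis by (simp add: min_def)
      qed
    qed auto
    show "\<beta> (2 - 8 * ?r (snd p), \<phi> (?s (snd p))) =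
        \<phi> (\<alpha> (min (min (4 * ?r (snd p) - 1) (2 - 2 * ?r (snd p))) (1 - fst p), ?s (snd p)))"
      if "p \<in> topspace ?T" "?r (snd p) = 1/4" for p
    proof -
      have "fst p \<le> 1" using that(1) by auto
      then show ?thesis unfolding that(2) by (simp add: \<alpha>0 \<beta>0 min_def)
    qed
    show "\<phi> (\<lambda>i. 8 * snd p i) =
        (if ?r (snd p) \<le> 1/4 then \<beta> (2 - 8 * ?r (snd p), \<phi> (?s (snd p)))
         else \<phi> (\<alpha> (min (min (4 * ?r (snd p) - 1) (2 - 2 * ?r (snd p))) (1 - fst p), ?s (snd p))))"
      if "?r (snd p) = 1/8" for p
      unfolding ball_dir_eq_scale[OF that] unfolding that by (simp add: \<beta>1)
  qed auto
  have H1S: "H1 (t, x) = \<phi> (\<alpha> (min 0 (1 - t), x))" if "x \<in> ball_bd n" for t x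
    using that by (simp add: H1_def mem_ball_bd ball_dir_bd)
  \<comment> \<open>The radius \<open>q\<close> of the stretched ball grows from 1/8 to 1, pushing
    the collar out of the ball. Outside it the time of \<beta> falls from 1 with slope 8, but never
    below \<open>t\<close>. At \<open>t = 0\<close> this is the end of \<open>H1\<close>. At radius
    1 the falling term is \<open>7 * t - 6\<close>, which is at most \<open>t\<close>, so the
    boundary value is \<open>\<beta> (t, \<phi> x)\<close> and depends only on
    \<open>\<phi> x\<close>.\<close>
  define H2 where "H2 = (\<lambda>p. let t = fst p; x = snd p; r = ?r x; q = (1 + 7 * t) / 8 in
      if r \<le> q then \<phi> (\<lambda>i. (1 / q) * x i) else \<beta> (max t (1 - 8 * (r - q)), \<phi> (?s x)))"
  have cH2: "continuous_map ?P C H2"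
    unfolding H2_def Let_def
  proof (intro continuous_map_cases_le rPc)
    show "continuous_map ?P euclideanreal (\<lambda>p. (1 + 7 * fst p) / 8)"
      by (intro continuous_intros cfst) auto
    show "continuous_map (subtopology ?P {p \<in> topspace ?P. ?r (snd p) \<le> (1 + 7 * fst p) / 8}) C
        (\<lambda>p. \<phi> (\<lambda>i. 1 / ((1 + 7 * fst p) / 8) * snd p i))"
    proof (rule scaleP)
      let ?U = "{p \<in> topspace ?P. ?r (snd p) \<le> (1 + 7 * fst p) / 8}"
      show "continuous_map (subtopology ?P ?U) euclideanreal (\<lambda>p. 1 / ((1 + 7 * fst p) / 8))"
        by (intro continuous_intros cfst') auto
      show "\<bar>1 / ((1 + 7 * fst p) / 8)\<bar> * ?r (snd p) \<le> 1" if "p \<in> ?U" for p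
      proof -
        have "0 \<le> fst p" "?r (snd p) \<le> (1 + 7 * fst p) / 8" using that by auto
        then show ?thesis by (simp add: divide_simps)
      qed
    qed
    show "continuous_map (subtopology ?P {p \<in> topspace ?P. (1 + 7 * fst p) / 8 \<le> ?r (snd p)}) C
        (\<lambda>p. \<beta> (max (fst p) (1 - 8 * (?r (snd p) - (1 + 7 * fst p) / 8)), \<phi> (?s (snd p))))"
    proof (rule continuous_map_homotopy_compose[OF \<beta>C])
      let ?T = "subtopology ?P {p \<in> topspace ?P. (1 + 7 * fst p) / 8 \<le> ?r (snd p)}"
      show "continuous_map ?T euclideanreal (\<lambda>p. max (fst p) (1 - 8 * (?r (snd p) - (1 + 7 * fst p) / 8)))"
        by (intro continuous_intros continuous_map_real_max rPc' cfst') auto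
      show "continuous_map ?T ?A (\<lambda>p. \<phi> (?s (snd p)))"
      proof (rule \<phi>dirP)
        fix p assume "p \<in> {p \<in> topspace ?P. (1 + 7 * fst p) / 8 \<le> ?r (snd p)}"
        then have "0 < (1 + 7 * fst p) / 8" and le: "(1 + 7 * fst p) / 8 \<le> ?r (snd p)" by auto
        then show "0 < ?r (snd p)" using less_le_trans[OF _ le] by blast
      qed
      show "max (fst p) (1 - 8 * (?r (snd p) - (1 + 7 * fst p) / 8)) \<in> {0..1}" if "p \<in> topspace ?T" for p
      proof -
        have "(1 + 7 * fst p) / 8 \<le> ?r (snd p)" "0 \<le> fst p" "fst p \<le> 1" using that by auto
        then show ?thesis by (simp add: max_def)
      qed
    qed
    show "\<phi> (\<lambda>i. 1 / ((1 + 7 * fst p) / 8) * snd p i) =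
        \<beta> (max (fst p) (1 - 8 * (?r (snd p) - (1 + 7 * fst p) / 8)), \<phi> (?s (snd p)))"
      if "p \<in> topspace ?P" "?r (snd p) = (1 + 7 * fst p) / 8" for p
    proof -
      have d: "?s (snd p) = (\<lambda>i. 1 / ((1 + 7 * fst p) / 8) * snd p i)"
        by (rule ball_dir_eq_scale) (use that in simp)
      have "fst p \<le> 1" using that(1) by auto
      then have m: "max (fst p) (1 - 8 * (?r (snd p) - (1 + 7 * fst p) / 8)) = 1"
        unfolding that(2) by simp
      show ?thesis unfolding m \<beta>1 d ..
    qed
  qed
  have H2S: "H2 (t, x) = \<beta> (t, \<phi> x)" if "x \<in> ball_bd n" "t \<in> {0..1}" for t x
  \<comment> \<open>At \<open>t = 1\<close> the radius \<open>q\<close> is 1, so boundary points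
    fall under the first branch of \<open>H2\<close>.\<close>
  proof (cases "t = 1")
    case True
    then show ?thesis using that by (simp add: H2_def mem_ball_bd \<beta>1)
  next
    case False
    have r: "?r x = 1" "?s x = x" using that by (auto simp: mem_ball_bd ball_dir_bd)
    have "\<not> 1 \<le> (1 + 7 * t) / 8" using False that by simp
    moreover have "1 - 8 * (1 - (1 + 7 * t) / 8) \<le> t" using that by (simp add: field_simps)
    then have "max t (1 - 8 * (1 - (1 + 7 * t) / 8)) = t" by (rule max_absorb1)
    ultimately show ?thesis by (simp only: H2_def Let_def fst_conv snd_conv r if_False)
  qed
  have fib1: "H1 (t, x) = H1 (t, x')"
    if "t \<in> {0..1}" "x \<in> topspace ?D" "x' \<in> topspace ?D" "\<phi> x = \<phi> x'" for t x x'
  proof -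
    have "min 0 (1 - t) = 0" using that by simp
    moreover have "x = x' \<or> x \<in> ball_bd n \<and> x' \<in> ball_bd n"
      using fib[OF _ _ that(4)] that(2,3) unfolding topspace_ball_top by blast
    ultimately show ?thesis
      by (elim disjE conjE) (simp_all only: H1S \<alpha>0 that(4))
  qed
  have fib2: "H2 (t, x) = H2 (t, x')"
    if "t \<in> {0..1}" "x \<in> topspace ?D" "x' \<in> topspace ?D" "\<phi> x = \<phi> x'" for t x x'
  proof -
    have "x = x' \<or> x \<in> ball_bd n \<and> x' \<in> ball_bd n"
      using fib[OF _ _ that(4)] that(2,3) unfolding topspace_ball_top by blast
    then show ?thesis
      by (elim disjE conjE) (simp_all only: H2S[OF _ that(1)] that(4))
  qed
  have surj: "\<phi> ` topspace ?D = topspace C" by (rule \<phi>(2))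
  obtain G1 where G1: "continuous_map (prod_topology ?I C) C G1"
    and G1H: "\<And>t x. t \<in> {0..1} \<Longrightarrow> x \<in> topspace ?D \<Longrightarrow> G1 (t, \<phi> x) = H1 (t, x)"
    by (rule quotient_homotopy_lift[OF \<phi>(1) surj compact_space_ball_top C cH1])
       (erule (3) fib1, erule that, blast)
  obtain G2 where G2: "continuous_map (prod_topology ?I C) C G2"
    and G2H: "\<And>t x. t \<in> {0..1} \<Longrightarrow> x \<in> topspace ?D \<Longrightarrow> G2 (t, \<phi> x) = H2 (t, x)"
    by (rule quotient_homotopy_lift[OF \<phi>(1) surj compact_space_ball_top C cH2])
       (erule (3) fib2, erule that, blast)
  have ba: "H1 (0, x) = b (a' x)" if x: "x \<in> topspace ?D" for x
  proof (cases "?r x \<le> 1/2")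
    case True
    then have [simp]: "a' x = (\<lambda>i. 2 * x i)" by (simp add: a'_def)
    have [simp]: "?r (\<lambda>i. 2 * x i) = 2 * ?r x" "?s (\<lambda>i. 2 * x i) = ?s x"
      by (simp_all add: ball_norm_scale ball_dir_scale)
    have "H1 (0, x) = (if ?r x \<le> 1/8 then \<phi> (\<lambda>i. 8 * x i)
      else if ?r x \<le> 1/4 then \<beta> (2 - 8 * ?r x, \<phi> (?s x)) else \<phi> (\<alpha> (4 * ?r x - 1, ?s x)))"
      using True by (simp add: H1_def min_def)
    then show ?thesis by (simp add: b_def)
  next
    case False
    then have y: "a' x = \<alpha> (2 - 2 * ?r x, ?s x)" "a' x \<in> ball_bd n"
      using \<alpha>S[OF _ dirD[OF x]] rD[OF x] by (auto simp: a'_def)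
    then have "b (a' x) = \<phi> (a' x)"
      by (simp add: b_def mem_ball_bd ball_dir_bd \<alpha>1)
    moreover have "H1 (0, x) = \<phi> (\<alpha> (2 - 2 * ?r x, ?s x))"
      using False rD[OF x] by (simp add: H1_def min_def)
    ultimately show ?thesis using y by simp
  qed
  have H12: "H1 (1, x) = H2 (0, x)" if x: "x \<in> topspace ?D" for x
  proof -
    let ?\<rho> = "?r x"
    have e: "1 - 8 * (?\<rho> - 1 / 8) = 2 - 8 * ?\<rho>" "1 / (1 / 8) = (8::real)"
      "(1 + 7 * 0) / 8 = (1/8::real)" by simp_all
    have m: "min (min (4 * ?\<rho> - 1) (2 - 2 * ?\<rho>)) (1 - 1) = 0" "max 0 (2 - 8 * ?\<rho>) = 0" if "1/4 < ?\<rho>"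
      using that rD[OF x] by simp_all
    have m': "max 0 (2 - 8 * ?\<rho>) = 2 - 8 * ?\<rho>" if "?\<rho> \<le> 1/4"
      using that by simp
    consider "?\<rho> \<le> 1/8" | "1/8 < ?\<rho>" "?\<rho> \<le> 1/4" | "1/8 < ?\<rho>" "1/4 < ?\<rho>" by linarith
    then show ?thesis
    proof cases
      case 1
      then show ?thesis unfolding H1_def H2_def Let_def fst_conv snd_conv e by simp
    next
      case 2
      then have "(?\<rho> \<le> 1/8) = False" by simp
      with 2 show ?thesis
        unfolding H1_def H2_def Let_def fst_conv snd_conv e by (simp only: if_True if_False m')
    next
      case 3
      then have "(?\<rho> \<le> 1/8) = False" "(?\<rho> \<le> 1/4) = False" by simp_all
      with 3 show ?thesis
        unfolding H1_def H2_def Let_def fst_conv snd_conv e by (simp only: if_False m \<alpha>0 \<beta>0)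
    qed
  qed
  have H21: "H2 (1, x) = \<phi> x" if "x \<in> topspace ?D" for x
  proof -
    have "(1 + 7 * 1) / 8 = (1::real)" by simp
    then show ?thesis
      using rD[OF that] by (simp only: H2_def Let_def fst_conv snd_conv if_True div_by_1 mult_1_left)
  qed
  have G: "(b \<circ> a) c = G1 (0, c)" "G1 (1, c) = G2 (0, c)" "id c = G2 (1, c)"
    if "c \<in> topspace C" for c
  proof -
    from that have "c \<in> \<phi> ` topspace ?D" unfolding surj .
    then obtain x where x: "x \<in> topspace ?D" "c = \<phi> x" by (elim imageE) (rule that)
    show "(b \<circ> a) c = G1 (0, c)" "G1 (1, c) = G2 (0, c)" "id c = G2 (1, c)"
      unfolding x(2) o_apply id_apply
      by (simp_all only: G1H[OF _ x(1)] G2H[OF _ x(1)] aa'[OF x(1)] ba[OF x(1)] H12[OF x(1)] H21[OF x(1)]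
          atLeastAtMost_iff order.refl zero_le_one)
  qed
  have 1: "homotopic_with (\<lambda>_. True) C C (\<lambda>c. G1 (0, c)) (\<lambda>c. G1 (1, c))"
    unfolding homotopic_with_def by (rule exI[of _ G1]) (simp add: G1)
  have 2: "homotopic_with (\<lambda>_. True) C C (\<lambda>c. G2 (0, c)) (\<lambda>c. G2 (1, c))"
    unfolding homotopic_with_def by (rule exI[of _ G2]) (simp add: G2)
  have "homotopic_with (\<lambda>_. True) C C (\<lambda>c. G1 (1, c)) id"
    by (rule homotopic_with_eq[OF 2]) (erule G(2), erule G(3), rule refl)
  moreover have "homotopic_with (\<lambda>_. True) C C (b \<circ> a) (\<lambda>c. G1 (1, c))"
    by (rule homotopic_with_eq[OF 1]) (erule G(1), rule refl, rule refl)
  ultimately have "homotopic_with (\<lambda>_. True) C C (b \<circ> a) id"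
    by (rule homotopic_with_trans[rotated])
  then show ?thesis
    by (rule homotopy_dominated_contractibility[OF b a _ contractible_ball_top])
qed

section \<open>Characteristic maps and retractions\<close>

text \<open>The parameters whose point on the segment lies in the closure form a closed set
  containing the half-open interval, hence also 1. This shows that balls and cubes are the closures
  of their interiors.\<close>

lemma in_closure_of_segment:
  fixes S B :: "(nat \<Rightarrow> real) set"
  assumes seg: "\<And>t. 0 \<le> t \<Longrightarrow> t < 1 \<Longrightarrow> (\<lambda>i. (1 - t) * c i + t * x i) \<in> S - B" and x: "x \<in> S"
  shows "x \<in> subtopology (powertop_real UNIV) S closure_of (S - B)"
proof -
  let ?T = "subtopology (powertop_real UNIV) S"
  let ?I = "top_of_set {0..1::real}"
  define \<gamma> where "\<gamma> = (\<lambda>t i. (1 - t) * c i + t * x i)"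
  have \<gamma>1: "\<gamma> 1 = x" by (simp add: \<gamma>_def)
  have "continuous_map ?I ?T \<gamma>"
    unfolding continuous_map_into_powertop_sub
  proof (intro conjI allI)
    show "continuous_map ?I euclideanreal (\<lambda>t. \<gamma> t i)" for i
      unfolding \<gamma>_def by (simp add: continuous_map_iff_continuous continuous_intros)
    show "\<gamma> \<in> topspace ?I \<rightarrow> S"
    proof
      fix t assume "t \<in> topspace ?I"
      then consider "0 \<le> t" "t < 1" | "t = 1" by fastforce
      then show "\<gamma> t \<in> S"
      proof cases
        case 1
        then show ?thesis using seg[of t] by (simp add: \<gamma>_def)
      next
        case 2
        then show ?thesis using \<gamma>1 x by simp
      qed
    qed
  qed
  then have "closedin ?I {t \<in> topspace ?I. \<gamma> t \<in> ?T closure_of (S - B)}"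
    by (rule closedin_continuous_map_preimage) (rule closedin_closure_of)
  then have "closed {t \<in> topspace ?I. \<gamma> t \<in> ?T closure_of (S - B)}"
    by (rule closedin_closed_trans) simp
  moreover have "{0..<1} \<subseteq> {t \<in> topspace ?I. \<gamma> t \<in> ?T closure_of (S - B)}"
  proof
    fix t :: real assume t: "t \<in> {0..<1}"
    then have "\<gamma> t \<in> S - B" using seg[of t] by (simp add: \<gamma>_def)
    moreover have "S - B \<subseteq> ?T closure_of (S - B)"
      by (rule closure_of_subset) simp
    ultimately show "t \<in> {t \<in> topspace ?I. \<gamma> t \<in> ?T closure_of (S - B)}"
      using t by auto
  qed
  ultimately have "closure {0..<1} \<subseteq> {t \<in> topspace ?I. \<gamma> t \<in> ?T closure_of (S - B)}"
    by (rule closure_minimal[rotated])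
  then have "1 \<in> {t \<in> topspace ?I. \<gamma> t \<in> ?T closure_of (S - B)}"
    by (simp add: subset_iff)
  then show ?thesis using \<gamma>1 by simp
qed

lemma ball_top_dense: "topspace (ball_top n) \<subseteq> ball_top n closure_of (topspace (ball_top n) - ball_bd n)"
proof
  fix x assume x: "x \<in> topspace (ball_top n)"
  then have x': "ball_norm n x \<le> 1" "\<forall>i\<ge>n. x i = 0" using mem_cball_n[of x n] by auto
  have "(\<lambda>i. (1 - t) * 0 + t * x i) \<in> cball_n n - ball_bd n" if t: "0 \<le> t" "t < 1" for t
  proof -
    have "ball_norm n (\<lambda>i. t * x i) \<le> t * 1"
      unfolding ball_norm_scale using x' t by (simp add: mult_left_le)
    then have "ball_norm n (\<lambda>i. t * x i) < 1" using t by linarith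
    moreover have "\<forall>i\<ge>n. t * x i = 0" using x' by simp
    ultimately show ?thesis
      using mem_cball_n[of "\<lambda>i. t * x i" n] mem_ball_bd[of "\<lambda>i. t * x i" n] by simp
  qed
  from in_closure_of_segment[OF this] x
  show "x \<in> ball_top n closure_of (topspace (ball_top n) - ball_bd n)"
    by (simp add: ball_top_eq)
qed

lemma cube_top_dense: "topspace (cube_top n) \<subseteq> cube_top n closure_of (topspace (cube_top n) - cube_bd n)"
proof
  fix x assume x: "x \<in> topspace (cube_top n)"
  let ?c = "\<lambda>i. if i < n then 1/2 else 0 :: real"
  have "(\<lambda>i. (1 - t) * ?c i + t * x i) \<in> cube n - cube_bd n" if t: "0 \<le> t" "t < 1" for t
  proof -
    define y where "y = (\<lambda>i. (1 - t) * ?c i + t * x i)"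
    have "0 < y i \<and> y i < 1" if i: "i < n" for i
    proof -
      have "0 \<le> x i" "x i \<le> 1" using x i by auto
      then have "0 \<le> t * x i" "t * x i \<le> t" using t by (auto simp: mult_left_le)
      then show ?thesis using i t by (simp add: y_def field_simps)
    qed
    moreover have "y i = 0" if "n \<le> i" for i using x that by (simp add: y_def)
    ultimately have "y \<in> cube n - cube_bd n"
      unfolding cube_bd_eq by (force simp: less_imp_le)
    then show ?thesis by (simp only: y_def)
  qed
  from in_closure_of_segment[OF this] x
  show "x \<in> cube_top n closure_of (topspace (cube_top n) - cube_bd n)"
    by (simp add: cube_top_eq)
qed

lemma characteristic_map_interior:
  assumes \<phi>: "characteristic_map K e Q S \<phi>" and e: "e \<subseteq> topspace (cw_space K)"
  shows "\<phi> ` (topspace Q - S) = e" "inj_on \<phi> (topspace Q - S)"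
proof -
  have hom: "homeomorphic_map (subtopology Q (topspace Q - S)) (subtopology (cw_space K) e) \<phi>"
    using \<phi> unfolding characteristic_map_def by blast
  have top: "topspace (subtopology Q (topspace Q - S)) = topspace Q - S"
    "topspace (subtopology (cw_space K) e) = e"
    using e by (auto simp only: topspace_subtopology)
  show "\<phi> ` (topspace Q - S) = e"
    using homeomorphic_imp_surjective_map[OF hom] unfolding top .
  show "inj_on \<phi> (topspace Q - S)"
    using homeomorphic_imp_injective_map[OF hom] unfolding top .
qed

text \<open>Density of the interior puts the image into the closure of the cell. Conversely the
  image is compact in a Hausdorff space, hence closed, and contains the cell.\<close>

lemma characteristic_map_image:
  assumes \<phi>: "characteristic_map K e Q S \<phi>" and Q: "compact_space Q"
    and K: "Hausdorff_space (cw_space K)" and e: "e \<subseteq> topspace (cw_space K)"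
    and dense: "topspace Q \<subseteq> Q closure_of (topspace Q - S)"
  shows "\<phi> ` topspace Q = closed_cell K e"
proof
  have cont: "continuous_map Q (cw_space K) \<phi>"
    using \<phi> unfolding characteristic_map_def by blast
  have img: "\<phi> ` (topspace Q - S) = e"
    by (rule characteristic_map_interior(1)[OF \<phi> e])
  have "\<phi> ` (Q closure_of (topspace Q - S)) \<subseteq> closed_cell K (\<phi> ` (topspace Q - S))"
    by (rule continuous_map_image_closure_subset[OF cont])
  then show "\<phi> ` topspace Q \<subseteq> closed_cell K e"
    using dense unfolding img by blast
  have "compactin (cw_space K) (\<phi> ` topspace Q)"
    using Q cont unfolding compact_space_def by (rule image_compactin)
  then have "closedin (cw_space K) (\<phi> ` topspace Q)"
    by (rule compactin_imp_closedin[OF K])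
  moreover have "e \<subseteq> \<phi> ` topspace Q" unfolding img[symmetric] by blast
  ultimately show "closed_cell K e \<subseteq> \<phi> ` topspace Q"
    by (rule closure_of_minimal[rotated])
qed

section \<open>Pasting and retracts\<close>

lemma continuous_map_closed_Un:
  assumes "closedin X A" "closedin X B" "topspace X \<subseteq> A \<union> B"
    and f: "continuous_map (subtopology X A) Y f" "continuous_map (subtopology X B) Y f"
  shows "continuous_map X Y f"
  unfolding continuous_map_closedin
proof (intro conjI allI impI)
  have A: "A \<subseteq> topspace X" and B: "B \<subseteq> topspace X" using assms closedin_subset by blast+
  note top = topspace_subtopology_subset[OF A] topspace_subtopology_subset[OF B]
  show "f \<in> topspace X \<rightarrow> topspace Y"
    using continuous_map_funspace[OF f(1)] continuous_map_funspace[OF f(2)] assms(3)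
    unfolding top by blast
  fix C assume C: "closedin Y C"
  have "closedin X {x \<in> A. f x \<in> C}"
    using closedin_continuous_map_preimage[OF f(1) C] assms(1) closedin_trans_full unfolding top by blast
  moreover have "closedin X {x \<in> B. f x \<in> C}"
    using closedin_continuous_map_preimage[OF f(2) C] assms(2) closedin_trans_full unfolding top by blast
  ultimately have "closedin X ({x \<in> A. f x \<in> C} \<union> {x \<in> B. f x \<in> C})"
    by (rule closedin_Un)
  also have "{x \<in> A. f x \<in> C} \<union> {x \<in> B. f x \<in> C} = {x \<in> topspace X. f x \<in> C}"
    using A B assms(3) by blast
  finally show "closedin X {x \<in> topspace X. f x \<in> C}" .
qed

lemma contractible_space_retract:
  assumes X: "contractible_space (subtopology X C)" and "C' \<subseteq> C"
    and r: "continuous_map (subtopology X C) (subtopology X C') r" "\<And>x. x \<in> C' \<Longrightarrow> r x = x"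
  shows "contractible_space (subtopology X C')"
proof (rule homotopy_dominated_contractibility[OF r(1) _ _ X])
  show id: "continuous_map (subtopology X C') (subtopology X C) id"
    using assms(2) by (auto simp: continuous_map_in_subtopology)
  show "homotopic_with (\<lambda>x. True) (subtopology X C') (subtopology X C') (r \<circ> id) id"
  proof (rule homotopic_with_equal)
    show "continuous_map (subtopology X C') (subtopology X C') (r \<circ> id)"
      by (rule continuous_map_compose[OF id r(1)])
  qed (use r(2) in auto)
qed

text \<open>Central projection of the cube \<open>I\<^sup>n \<times> I\<close> from the point \<open>(1/2, \<dots>, 1/2, -1)\<close> onto the union
  of all faces other than \<open>I\<^sup>n \<times> {0}\<close>.\<close>

definition box_scale :: "nat \<Rightarrow> (nat \<Rightarrow> real) \<Rightarrow> real" where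
  "box_scale n x = max (cube_norm n x) ((x n + 1) / 2)"

definition box_retraction :: "nat \<Rightarrow> (nat \<Rightarrow> real) \<Rightarrow> nat \<Rightarrow> real" where
  "box_retraction n x = (\<lambda>i. if i < n then 1/2 + (x i - 1/2) / box_scale n x
     else if i = n then (x n + 1) / box_scale n x - 1 else 0)"

definition open_box :: "nat \<Rightarrow> (nat \<Rightarrow> real) set" where
  "open_box n = {x \<in> cube (Suc n). (\<exists>i<n. x i = 0 \<or> x i = 1) \<or> x n = 1}"

text \<open>The ray from the centre of projection is stretched by \<open>1 / box_scale n x\<close>.
  It meets a side face when the scale is \<open>cube_norm n x\<close> and the top face when it is
  \<open>(x n + 1) / 2\<close>, so the maximum selects the face met first. The lower bound allows
  the division; the upper bound keeps the image at nonnegative height.\<close>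

lemma box_scale_bounds:
  assumes "x \<in> cube (Suc n)"
  shows "1/2 \<le> box_scale n x" "box_scale n x \<le> 1"
proof -
  have "0 \<le> x n" "x n \<le> 1" "cube_norm n x \<le> 1" using assms cube_norm_le[of n x] by auto
  then show "1/2 \<le> box_scale n x" "box_scale n x \<le> 1" unfolding box_scale_def max_def by simp_all
qed

lemma box_retraction_open_box:
  assumes "x \<in> open_box n"
  shows "box_retraction n x = x"
proof -
  have x: "x \<in> cube (Suc n)" and "(\<exists>i<n. x i = 0 \<or> x i = 1) \<or> x n = 1"
    using assms by (simp_all add: open_box_def)
  then have "1 \<le> box_scale n x"
  proof (elim disjE exE conjE)
    fix i assume "i < n" "x i = 0"
    then show ?thesis using cube_norm_ge[of i n x] by (simp add: box_scale_def)
  next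
    fix i assume "i < n" "x i = 1"
    then show ?thesis using cube_norm_ge[of i n x] by (simp add: box_scale_def)
  qed (simp add: box_scale_def)
  then have "box_scale n x = 1" using box_scale_bounds[OF x] by simp
  then show ?thesis using x by (auto simp: box_retraction_def)
qed

lemma box_retraction_in_open_box:
  assumes x: "x \<in> cube (Suc n)"
  shows "box_retraction n x \<in> open_box n"
proof -
  let ?m = "box_scale n x"
  let ?r = "box_retraction n x"
  have m: "1/2 \<le> ?m" "?m \<le> 1" using box_scale_bounds[OF x] .
  have *: "2 * ?r i - 1 = (2 * x i - 1) / ?m" if "i < n" for i
    using that by (simp add: box_retraction_def diff_divide_distrib)
  have "0 \<le> ?r i \<and> ?r i \<le> 1" if "i < n" for i
  proof -
    have "\<bar>2 * x i - 1\<bar> \<le> ?m" using cube_norm_ge[OF that, of x] by (simp add: box_scale_def)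
    then have "\<bar>2 * ?r i - 1\<bar> \<le> 1" using m by (simp add: *[OF that])
    then show ?thesis by linarith
  qed
  moreover have "0 \<le> ?r n \<and> ?r n \<le> 1"
  proof -
    have xn: "0 \<le> x n" "x n \<le> 1" using x by auto
    have "(x n + 1) / 2 \<le> ?m" by (simp add: box_scale_def)
    then have "x n + 1 \<le> 2 * ?m" by simp
    then have "(x n + 1) / ?m \<le> 2" using m by (simp add: divide_le_eq)
    moreover have "1 \<le> (x n + 1) / ?m" using m xn by (simp add: le_divide_eq)
    ultimately show ?thesis by (simp add: box_retraction_def)
  qed
  moreover have "(\<exists>i<n. ?r i = 0 \<or> ?r i = 1) \<or> ?r n = 1"
  proof (cases "cube_norm n x \<le> (x n + 1) / 2")
    case True
    then have "?m = (x n + 1) / 2" by (simp add: box_scale_def)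
    then show ?thesis using m by (simp add: box_retraction_def divide_simps)
  next
    case False
    then have "?m = cube_norm n x" by (simp add: box_scale_def)
    then obtain i where i: "i < n" "\<bar>2 * x i - 1\<bar> = ?m"
      using cube_norm_attained[of n x] m by auto
    then have "\<bar>2 * ?r i - 1\<bar> = 1" using m by (simp add: *)
    then have "?r i = 0 \<or> ?r i = 1" by linarith
    then show ?thesis using i by blast
  qed
  ultimately show ?thesis
    by (auto simp: open_box_def less_Suc_eq box_retraction_def)
qed

lemma continuous_map_box_retraction:
  "continuous_map (cube_top (Suc n)) (cube_top (Suc n)) (box_retraction n)"
proof -
  let ?T = "cube_top (Suc n)"
  have pr: "continuous_map ?T euclideanreal (\<lambda>x. x i)" for i
    unfolding cube_top_eq by (rule continuous_map_powertop_proj)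
  have sc: "continuous_map ?T euclideanreal (box_scale n)"
    unfolding box_scale_def
    by (intro continuous_map_real_max continuous_map_cube_norm_cube_top continuous_intros pr) simp
  have nz: "box_scale n x \<noteq> 0" if "x \<in> topspace ?T" for x
    using box_scale_bounds[of x n] that by auto
  have "continuous_map ?T euclideanreal (\<lambda>x. box_retraction n x i)" for i
  proof -
    consider "i < n" | "i = n" | "n < i" by linarith
    then show ?thesis
    proof cases
      case 1
      have "continuous_map ?T euclideanreal (\<lambda>x. 1/2 + (x i - 1/2) / box_scale n x)"
        by (intro continuous_intros pr sc) (use nz in auto)
      then show ?thesis using 1 by (simp add: box_retraction_def)
    next
      case 2
      have "continuous_map ?T euclideanreal (\<lambda>x. (x n + 1) / box_scale n x - 1)"
        by (intro continuous_intros pr sc) (use nz in auto)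
      then show ?thesis using 2 by (simp add: box_retraction_def)
    next
      case 3
      then show ?thesis by (simp add: box_retraction_def)
    qed
  qed
  moreover have "box_retraction n \<in> topspace ?T \<rightarrow> cube (Suc n)"
  proof
    fix x assume "x \<in> topspace ?T"
    then have "box_retraction n x \<in> open_box n"
      unfolding topspace_cube_top by (rule box_retraction_in_open_box)
    then show "box_retraction n x \<in> cube (Suc n)" unfolding open_box_def by blast
  qed
  ultimately show ?thesis
    using continuous_map_into_powertop_sub[of ?T "cube (Suc n)" "box_retraction n"]
    unfolding cube_top_eq by blast
qed

lemma bottom_face_subset: "cube n \<subseteq> cube (Suc n)" "cube n \<subseteq> cube_bd (Suc n)" "cube_bd n \<subseteq> cube n"
  by (auto simp: cube_bd_eq less_Suc_eq)

text \<open>In a collapse these three pieces are sent to the large cell, to its free face and into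
  the remaining subcomplex respectively.\<close>

lemma cube_Suc_cases:
  assumes "x \<in> cube (Suc n)"
  obtains "x \<in> cube (Suc n) - cube_bd (Suc n)" | "x \<in> cube n - cube_bd n" | "x \<in> open_box n"
proof (cases "x \<in> open_box n")
  case False
  then have x: "\<And>i. i < n \<Longrightarrow> x i \<noteq> 0 \<and> x i \<noteq> 1" "x n \<noteq> 1"
    using assms by (auto simp: open_box_def)
  show thesis
  proof (cases "x n = 0")
    case True
    then have "x i = 0" if "n \<le> i" for i using assms that by (cases "i = n") auto
    then have "x \<in> cube n" using assms by auto
    moreover have "x \<notin> cube_bd n" using x by (auto simp: cube_bd_eq)
    ultimately show thesis using that(2) by simp
  next
    case False
    then have "x \<notin> cube_bd (Suc n)" using x by (auto simp: cube_bd_eq less_Suc_eq)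
    then show thesis using assms that(1) by simp
  qed
qed (use that(3) in simp)

section \<open>Cells of h-regular complexes\<close>

text \<open>A form of the hypotheses that passes to subcomplexes, so that it survives every step of
  a sequence of collapses.\<close>

locale h_regular_cw =
  fixes K :: "'a cw"
  assumes Hausdorff: "Hausdorff_space (cw_space K)"
    and finite_cells: "finite (cells K)"
    and Union_cells: "\<Union>(cells K) = topspace (cw_space K)"
    and disjoint_cells: "pairwise disjnt (cells K)"
    and char_map: "\<And>e. e \<in> cells K \<Longrightarrow> characteristic_map K e
        (ball_top (cell_dim K e)) (ball_bd (cell_dim K e)) (char_map K e)"
    and h_regular: "h_regular K"
begin

section \<open>Incidence of cells\<close>

abbreviation face :: "'a set \<Rightarrow> 'a set \<Rightarrow> bool" where
  "face e e' \<equiv> e \<subseteq> closed_cell K e'"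

lemma cell_subset_topspace: "e \<in> cells K \<Longrightarrow> e \<subseteq> topspace (cw_space K)"
  using Union_cells by blast

lemma cells_meet_eq:
  assumes "e \<in> cells K" "f \<in> cells K" "x \<in> e" "x \<in> f"
  shows "e = f"
  using disjoint_cells assms unfolding pairwise_def disjnt_def by blast

lemma char_map_image:
  assumes "e \<in> cells K"
  shows "char_map K e ` (topspace (ball_top (cell_dim K e)) - ball_bd (cell_dim K e)) = e"
    and "inj_on (char_map K e) (topspace (ball_top (cell_dim K e)) - ball_bd (cell_dim K e))"
    and "char_map K e ` topspace (ball_top (cell_dim K e)) = closed_cell K e"
  using characteristic_map_interior[OF char_map[OF assms] cell_subset_topspace[OF assms]]
    characteristic_map_image[OF char_map[OF assms] compact_space_ball_top Hausdorff
      cell_subset_topspace[OF assms] ball_top_dense] .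

lemma continuous_char_map:
  "e \<in> cells K \<Longrightarrow> continuous_map (ball_top (cell_dim K e)) (cw_space K) (char_map K e)"
  using char_map unfolding characteristic_map_def by blast

lemma cell_nonempty:
  assumes "e \<in> cells K"
  shows "e \<noteq> {}"
proof -
  have "(\<lambda>_. 0) \<in> topspace (ball_top (cell_dim K e)) - ball_bd (cell_dim K e)"
    by (simp add: ball_bd_eq)
  from imageI[OF this, of "char_map K e"] show ?thesis
    unfolding char_map_image(1)[OF assms] by blast
qed

lemma cell_subset_closed_cell: "e \<in> cells K \<Longrightarrow> face e e"
  by (rule closure_of_subset[OF cell_subset_topspace])

lemma closed_cell_mono: "face e e' \<Longrightarrow> closed_cell K e \<subseteq> closed_cell K e'"
  by (rule closure_of_minimal) simp_all

lemma skeleton_disjoint: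
  assumes "e \<in> cells K" "x \<in> e"
  shows "x \<notin> skeleton K (int (cell_dim K e) - 1)"
proof
  assume "x \<in> skeleton K (int (cell_dim K e) - 1)"
  then obtain f where "f \<in> cells K" "int (cell_dim K f) \<le> int (cell_dim K e) - 1" "x \<in> f"
    unfolding skeleton_def by blast
  then show False using cells_meet_eq[of e f x] assms by auto
qed

lemma char_map_bd:
  "e \<in> cells K \<Longrightarrow> char_map K e ` ball_bd (cell_dim K e) \<subseteq> skeleton K (int (cell_dim K e) - 1)"
  using char_map unfolding characteristic_map_def by blast

lemma char_map_bd_notin:
  "e \<in> cells K \<Longrightarrow> x \<in> ball_bd (cell_dim K e) \<Longrightarrow> char_map K e x \<notin> e"
  using char_map_bd skeleton_disjoint by blast

text \<open>Boundary points go to cells of lower dimension, so they never meet the image of the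
  interior, where the map is injective. This is the fibre condition of
  \<open>contractible_ball_adjunction\<close>.\<close>

lemma char_map_fibres:
  assumes e: "e \<in> cells K" and x: "x \<in> topspace (ball_top (cell_dim K e))"
    and y: "y \<in> topspace (ball_top (cell_dim K e))" and eq: "char_map K e x = char_map K e y"
  shows "x = y \<or> x \<in> ball_bd (cell_dim K e) \<and> y \<in> ball_bd (cell_dim K e)"
proof -
  let ?S = "ball_bd (cell_dim K e)"
  have in_e: "char_map K e z \<in> e \<longleftrightarrow> z \<notin> ?S" if "z \<in> topspace (ball_top (cell_dim K e))" for z
    using that imageI[of z "topspace (ball_top (cell_dim K e)) - ?S" "char_map K e"]
      char_map_bd_notin[OF e, of z]
    unfolding char_map_image(1)[OF e] by blast
  show ?thesis
  proof (cases "x \<in> ?S")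
    case True
    then show ?thesis using in_e[OF x] in_e[OF y] eq by simp
  next
    case False
    then have "y \<notin> ?S" using in_e[OF x] in_e[OF y] eq by simp
    with False have "x \<in> topspace (ball_top (cell_dim K e)) - ?S" "y \<in> topspace (ball_top (cell_dim K e)) - ?S"
      using x y by blast+
    then have "x = y" using inj_onD[OF char_map_image(2)[OF e]] eq by blast
    then show ?thesis ..
  qed
qed

lemma cell_boundary_subset: "e \<in> cells K \<Longrightarrow> cell_boundary K e \<subseteq> closed_cell K e"
  unfolding cell_boundary_def using char_map_image(3)[of e] ball_bd_subset[of "cell_dim K e"]
  unfolding topspace_ball_top[symmetric] by blast

lemma closed_cell_diff:
  assumes "e \<in> cells K" "x \<in> closed_cell K e" "x \<notin> e"
  obtains y where "y \<in> ball_bd (cell_dim K e)" "x = char_map K e y"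
  using assms char_map_image(1,3)[OF assms(1)] by blast

text \<open>A point of the closed cell outside the open cell comes from the boundary sphere, hence
  lies in the skeleton one dimension lower. The antisymmetry of \<open>face\<close> rests on
  this.\<close>

lemma dim_less:
  assumes "e \<in> cells K" "f \<in> cells K" "f \<noteq> e" "x \<in> f" "x \<in> closed_cell K e"
  shows "cell_dim K f < cell_dim K e"
proof -
  have "x \<notin> e" using cells_meet_eq[of e f x] assms by blast
  then obtain y where "y \<in> ball_bd (cell_dim K e)" "x = char_map K e y"
    using closed_cell_diff assms by blast
  then have "x \<in> skeleton K (int (cell_dim K e) - 1)"
    using char_map_bd[OF assms(1)] by blast
  then obtain g where "g \<in> cells K" "int (cell_dim K g) \<le> int (cell_dim K e) - 1" "x \<in> g"
    unfolding skeleton_def by blast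
  moreover from this have "g = f" using cells_meet_eq[of g f x] assms by blast
  ultimately show ?thesis by auto
qed

text \<open>Closed cells are subcomplexes, hence unions of open cells, and open cells are disjoint;
  so a cell that meets a closed cell lies in it.\<close>

lemma face_if_meets:
  assumes "e \<in> cells K" "f \<in> cells K" "x \<in> f" "x \<in> closed_cell K e"
  shows "face f e"
proof -
  obtain F where F: "subcomplex_cells K F" "closed_cell K e = \<Union>F"
    using conjunct2[OF bspec[OF h_regular[unfolded h_regular_def] assms(1)]] by blast
  then obtain g where "g \<in> F" "x \<in> g" using assms(4) by blast
  moreover from this have "g = f"
    using F(1) cells_meet_eq[of g f x] assms unfolding subcomplex_cells_def by blast
  ultimately show ?thesis using F(2) by blast
qed

lemma reflp_face: "A \<subseteq> cells K \<Longrightarrow> reflp_on A face"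
  unfolding reflp_on_def using cell_subset_closed_cell by blast

lemma transp_face: "transp_on A face"
  unfolding transp_on_def using closed_cell_mono by blast

lemma antisymp_face:
  assumes "A \<subseteq> cells K"
  shows "antisymp_on A face"
  unfolding antisymp_on_def
proof (intro ballI impI, rule ccontr)
  fix e f assume A: "e \<in> A" "f \<in> A" "face e f" "face f e" "e \<noteq> f"
  obtain x y where "x \<in> e" "y \<in> f" using A assms cell_nonempty by blast
  then have "cell_dim K f < cell_dim K e" "cell_dim K e < cell_dim K f"
    using dim_less[of e f y] dim_less[of f e x] A assms by blast+
  then show False by simp
qed

lemma face_Union_cells:
  assumes "F \<subseteq> cells K" "e \<in> cells K" "e \<subseteq> \<Union>F"
  shows "e \<in> F"
proof -
  obtain x where x: "x \<in> e" using cell_nonempty[OF assms(2)] by blast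
  then obtain f where "f \<in> F" "x \<in> f" using assms(3) by blast
  then show ?thesis using cells_meet_eq[of e f x] assms x by blast
qed

lemma subcomplex_cells_down:
  assumes "subcomplex_cells K F" "f \<in> F" "e \<in> cells K" "face e f"
  shows "e \<in> F"
proof (rule face_Union_cells[OF _ assms(3)])
  show "F \<subseteq> cells K" using assms(1) unfolding subcomplex_cells_def by blast
  have "closed_cell K f \<subseteq> \<Union>F" using assms(1,2) unfolding subcomplex_cells_def by blast
  with assms(4) show "e \<subseteq> \<Union>F" by (rule subset_trans)
qed

lemma Union_subcomplex_eq:
  assumes "subcomplex_cells K F"
  shows "\<Union>F = \<Union>(closed_cell K ` F)"
  using assms cell_subset_closed_cell unfolding subcomplex_cells_def by blast

lemma closedin_subcomplex:
  assumes "subcomplex_cells K F"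
  shows "closedin (cw_space K) (\<Union>F)"
proof -
  have "finite F" using assms finite_cells finite_subset unfolding subcomplex_cells_def by blast
  then show ?thesis unfolding Union_subcomplex_eq[OF assms]
    by (intro closedin_Union) auto
qed

lemma contractible_closed_cell:
  assumes e: "e \<in> cells K"
  shows "contractible_space (subtopology (cw_space K) (closed_cell K e))"
proof (rule contractible_ball_adjunction)
  let ?n = "cell_dim K e" and ?\<phi> = "char_map K e"
  let ?C = "subtopology (cw_space K) (closed_cell K e)" and ?D = "ball_top ?n"
  have img: "?\<phi> ` topspace ?D = closed_cell K e" by (rule char_map_image(3)[OF e])
  show "continuous_map (ball_top ?n) ?C ?\<phi>"
    unfolding continuous_map_in_subtopology
    using continuous_char_map[OF e] img by blast
  have "closed_cell K e \<subseteq> topspace (cw_space K)" by (rule closure_of_subset_topspace)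
  then show "?\<phi> ` topspace ?D = topspace ?C"
    unfolding img by (simp only: topspace_subtopology_subset)
  show "Hausdorff_space ?C" by (rule Hausdorff_space_subtopology[OF Hausdorff])
  have "?\<phi> ` ball_bd ?n = cell_boundary K e" by (simp only: cell_boundary_def)
  then have "subtopology ?C (?\<phi> ` ball_bd ?n) = subtopology (cw_space K) (cell_boundary K e)"
    using cell_boundary_subset[OF e] by (simp only: subtopology_subtopology Int_absorb1)
  then show "homotopy_equivalence_map (subtopology (Euclidean_space ?n) (ball_bd ?n))
      (subtopology ?C (?\<phi> ` ball_bd ?n)) ?\<phi>"
    using conjunct1[OF bspec[OF h_regular[unfolded h_regular_def] e]] by (simp only:)
qed (rule char_map_fibres[OF e])

text \<open>A map into the non-Hausdorff cone \<open>{z. face z e}\<close> over the boundary of \<open>e\<close> extends over the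
  closed cell: use the radial projection on an open collar and the apex \<open>e\<close> off the collar.\<close>

lemma extend_to_face_poset:
  assumes e: "e \<in> cells K" and F: "F \<subseteq> cells K" "e \<in> F"
    and X: "cell_boundary K e \<subseteq> \<Union>(F - {e})"
    and p: "continuous_map (subtopology (cw_space K) (\<Union>(F - {e}))) (poset_top (F - {e}) face) p"
    and p_face: "\<And>x. x \<in> cell_boundary K e \<Longrightarrow> face (p x) e"
  obtains q where "continuous_map (subtopology (cw_space K) (closed_cell K e)) (poset_top F face) q"
    "\<And>x. x \<in> cell_boundary K e \<Longrightarrow> q x = p x"
    "\<And>x. x \<in> closed_cell K e \<Longrightarrow> q x = e \<or> q x \<in> F - {e} \<and> face (q x) e"
proof -
  let ?F' = "F - {e}"
  let ?n = "cell_dim K e" and ?\<phi> = "char_map K e"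
  let ?D = "ball_top ?n" and ?r = "ball_norm ?n" and ?s = "ball_dir ?n"
  let ?C = "subtopology (cw_space K) (closed_cell K e)"
  have pF': "p x \<in> ?F'" if "x \<in> cell_boundary K e" for x
  proof -
    have "x \<in> topspace (subtopology (cw_space K) (\<Union>?F'))"
      using that X cell_boundary_subset[OF e] closure_of_subset_topspace[of "cw_space K" e]
      unfolding topspace_subtopology by blast
    then show ?thesis using continuous_map_funspace[OF p] unfolding topspace_poset_top by blast
  qed
  have dir: "?\<phi> (?s x) \<in> cell_boundary K e" if "x \<in> topspace ?D" "0 < ?r x" for x
    unfolding cell_boundary_def
    by (intro imageI ball_dir_in_bd) (use that in simp_all)
  define q' where "q' = (\<lambda>x. if ?r x \<le> 1/2 then e else p (?\<phi> (?s x)))"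
  have contr: "continuous_map ?D euclideanreal ?r" by (rule continuous_map_ball_norm) simp
  have "continuous_map ?D (poset_top F face) q'"
    unfolding continuous_map_def
  proof (intro conjI allI impI)
    show "q' \<in> topspace ?D \<rightarrow> topspace (poset_top F face)"
    proof
      fix x assume "x \<in> topspace ?D"
      then show "q' x \<in> topspace (poset_top F face)"
        using pF'[OF dir[of x]] F unfolding topspace_poset_top q'_def by auto
    qed
    fix U assume U: "openin (poset_top F face) U"
    show "openin ?D {x \<in> topspace ?D. q' x \<in> U}"
    \<comment> \<open>An open set containing the apex \<open>e\<close> contains all faces of
      \<open>e\<close> in \<open>F\<close>, hence every value of \<open>q'\<close>. If it misses
      \<open>e\<close>, its preimage lies in the open collar, where \<open>q'\<close> is a
      composition of continuous maps.\<close>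
    proof (cases "e \<in> U")
      case True
      have "q' x \<in> U" if x: "x \<in> topspace ?D" for x
      proof (cases "?r x \<le> 1/2")
        case False
        then have b: "?\<phi> (?s x) \<in> cell_boundary K e" using dir[of x] x by auto
        have "p (?\<phi> (?s x)) \<in> F" using pF'[OF b] by blast
        then have "p (?\<phi> (?s x)) \<in> U"
          using U True p_face[OF b] unfolding openin_poset_top by blast
        then show ?thesis using False by (simp add: q'_def)
      qed (simp add: q'_def True)
      then have "{x \<in> topspace ?D. q' x \<in> U} = topspace ?D" by blast
      then show ?thesis by (simp only: openin_topspace)
    next
      case False
      let ?O = "{x \<in> topspace ?D. ?r x \<in> {1/2<..}}"
      have O: "openin ?D ?O" by (rule openin_continuous_map_preimage[OF contr]) simp
      have dirc: "continuous_map (subtopology ?D ?O) (subtopology (Euclidean_space ?n) (ball_bd ?n)) ?s"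
        by (rule continuous_map_ball_dir) (auto intro: continuous_map_from_subtopology)
      have "continuous_map (subtopology ?D ?O) (cw_space K) (\<lambda>x. ?\<phi> (?s x))"
        by (rule continuous_map_compose[OF continuous_map_compose[OF dirc continuous_map_sphere_ball]
              continuous_char_map[OF e], unfolded o_def])
      moreover have "(\<lambda>x. ?\<phi> (?s x)) \<in> topspace (subtopology ?D ?O) \<rightarrow> \<Union>?F'"
      proof
        fix x assume "x \<in> topspace (subtopology ?D ?O)"
        then have "?\<phi> (?s x) \<in> cell_boundary K e" using dir[of x] by auto
        then show "?\<phi> (?s x) \<in> \<Union>?F'" using X by blast
      qed
      ultimately have "continuous_map (subtopology ?D ?O) (subtopology (cw_space K) (\<Union>?F')) (\<lambda>x. ?\<phi> (?s x))"
        unfolding continuous_map_in_subtopology by blast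
      from continuous_map_compose[OF this p]
      have pc: "continuous_map (subtopology ?D ?O) (poset_top ?F' face) (\<lambda>x. p (?\<phi> (?s x)))"
        by (simp only: o_def)
      have "openin (poset_top ?F' face) (U - {e})"
        using U False X unfolding openin_poset_top by blast
      from openin_continuous_map_preimage[OF pc this]
      have "openin ?D {x \<in> topspace (subtopology ?D ?O). p (?\<phi> (?s x)) \<in> U - {e}}"
        using openin_open_subtopology[OF O] by blast
      also have "{x \<in> topspace (subtopology ?D ?O). p (?\<phi> (?s x)) \<in> U - {e}} = {x \<in> topspace ?D. q' x \<in> U}"
        using False unfolding topspace_subtopology q'_def by (auto split: if_splits)
      finally show ?thesis .
    qed
  qed
  moreover have q'bd: "q' x = p (?\<phi> x)" if "x \<in> ball_bd ?n" for x
    using that unfolding q'_def by (simp add: mem_ball_bd ball_dir_bd)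
  have img: "?\<phi> ` topspace ?D = closed_cell K e" by (rule char_map_image(3)[OF e])
  have "quotient_map ?D ?C ?\<phi>"
  proof (rule continuous_imp_quotient_map[OF _ compact_space_ball_top])
    show "continuous_map ?D ?C ?\<phi>"
      unfolding continuous_map_in_subtopology
      using continuous_char_map[OF e] img by blast
    show "?\<phi> ` topspace ?D = topspace ?C"
      unfolding img
      using closure_of_subset_topspace[of "cw_space K" e] by (simp only: topspace_subtopology_subset)
  qed (rule Hausdorff_space_subtopology[OF Hausdorff])
  moreover have "q' x = q' x'" if "x \<in> topspace ?D" "x' \<in> topspace ?D" "?\<phi> x = ?\<phi> x'" for x x'
    using char_map_fibres[OF e that] q'bd[of x] q'bd[of x'] that(3) by auto
  ultimately obtain q where q: "continuous_map ?C (poset_top F face) q"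
    and qq': "\<And>x. x \<in> topspace ?D \<Longrightarrow> q (?\<phi> x) = q' x"
    using quotient_map_lift_exists[of ?D ?C ?\<phi> "poset_top F face" q'] by metis
  show thesis
  proof (rule that[OF q])
    fix x assume "x \<in> cell_boundary K e"
    then obtain y where "y \<in> ball_bd ?n" "x = ?\<phi> y" unfolding cell_boundary_def by blast
    then show "q x = p x" using qq'[of y] q'bd[of y] ball_bd_subset[of ?n]
      unfolding topspace_ball_top[symmetric] by auto
  next
    fix x assume "x \<in> closed_cell K e"
    then obtain y where y: "y \<in> topspace ?D" "x = ?\<phi> y" unfolding img[symmetric] by blast
    show "q x = e \<or> q x \<in> ?F' \<and> face (q x) e"
    proof (cases "?r y \<le> 1/2")
      case True
      then show ?thesis using qq'[of y] y by (simp add: q'_def)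
    next
      case False
      then have "?\<phi> (?s y) \<in> cell_boundary K e" using dir[of y] y by auto
      then show ?thesis
        using False qq'[of y] y pF' p_face by (simp add: q'_def)
    qed
  qed
qed

end

section \<open>Comparing a subcomplex with its face poset\<close>

context h_regular_cw
begin

text \<open>The cells are attached in order of dimension: after removal of a cell \<open>c\<close>
  of maximal dimension the rest is still a subcomplex. The condition on closed cells, rather than on
  open ones, places the values on the boundary of \<open>c\<close> below \<open>c\<close>, as the
  extension over \<open>c\<close> requires.\<close>

lemma exists_map_to_face_poset:
  assumes "subcomplex_cells K F"
  shows "\<exists>p. continuous_map (subtopology (cw_space K) (\<Union>F)) (poset_top F face) p \<and>
           (\<forall>y\<in>F. \<forall>x\<in>closed_cell K y. p x \<in> F \<and> face (p x) y)"
  using assms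
proof (induction "card F" arbitrary: F)
  case 0
  have "finite F"
    using "0.prems" finite_cells finite_subset unfolding subcomplex_cells_def by blast
  then have F: "F = {}" using "0.hyps" by simp
  have "continuous_map (subtopology (cw_space K) (\<Union>F)) (poset_top F face) (\<lambda>_. undefined)"
    unfolding F continuous_map_def by auto
  then show ?case unfolding F by blast
next
  case (Suc m)
  have FK: "F \<subseteq> cells K" and Fcl: "\<And>y. y \<in> F \<Longrightarrow> closed_cell K y \<subseteq> \<Union>F"
    using Suc.prems unfolding subcomplex_cells_def by blast+
  have fin: "finite F" using FK finite_cells finite_subset by blast
  have ne: "F \<noteq> {}" using Suc.hyps(2) by auto
  obtain c where c: "c \<in> F" and cmax: "\<And>y. y \<in> F \<Longrightarrow> cell_dim K y \<le> cell_dim K c"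
  proof -
    have "Max (cell_dim K ` F) \<in> cell_dim K ` F" using fin ne by (intro Max_in) auto
    then obtain c where "c \<in> F" "cell_dim K c = Max (cell_dim K ` F)" by force
    then show ?thesis using that[of c] fin by simp
  qed
  have cK: "c \<in> cells K" using c FK by blast
  let ?F' = "F - {c}"
  have sub': "subcomplex_cells K ?F'"
    unfolding subcomplex_cells_def
  proof (intro conjI ballI)
    show "?F' \<subseteq> cells K" using FK by blast
    fix y assume y: "y \<in> ?F'"
    show "closed_cell K y \<subseteq> \<Union>?F'"
    proof
      fix x assume x: "x \<in> closed_cell K y"
      then obtain z where z: "z \<in> F" "x \<in> z" using Fcl[of y] y by blast
      have "z \<noteq> c"
      proof
        assume "z = c"
        then have "cell_dim K c < cell_dim K y"
          using dim_less[of y c x] x z y FK by blast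
        then show False using cmax[of y] y by simp
      qed
      then show "x \<in> \<Union>?F'" using z by blast
    qed
  qed
  have "m = card ?F'" using Suc.hyps(2) c fin by simp
  from Suc.hyps(1)[OF this sub'] obtain p
    where p: "continuous_map (subtopology (cw_space K) (\<Union>?F')) (poset_top ?F' face) p"
      and pf: "\<And>y x. y \<in> ?F' \<Longrightarrow> x \<in> closed_cell K y \<Longrightarrow> p x \<in> ?F' \<and> face (p x) y"
    by blast
  have bd: "x \<in> \<Union>?F'" "x \<notin> c" "x \<in> closed_cell K c" if "x \<in> cell_boundary K c" for x
  proof -
    obtain z where z: "z \<in> ball_bd (cell_dim K c)" "x = char_map K c z"
      using \<open>x \<in> cell_boundary K c\<close> unfolding cell_boundary_def by blast
    then show "x \<notin> c" using char_map_bd_notin[OF cK] by blast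
    show "x \<in> closed_cell K c" using cell_boundary_subset[OF cK] that by blast
    then show "x \<in> \<Union>?F'" using Fcl[OF c] \<open>x \<notin> c\<close> by blast
  qed
  have pbd: "face (p x) c" if "x \<in> cell_boundary K c" for x
  proof -
    obtain y where y: "y \<in> ?F'" "x \<in> y" using bd(1)[OF \<open>x \<in> cell_boundary K c\<close>] by blast
    then have "x \<in> closed_cell K y" using cell_subset_closed_cell[of y] FK by blast
    then have "face (p x) y" using pf y by blast
    moreover have "face y c" using face_if_meets[OF cK _ y(2) bd(3)[OF that]] y FK by blast
    ultimately show ?thesis using closed_cell_mono by blast
  qed
  have "cell_boundary K c \<subseteq> \<Union>?F'" using bd(1) by blast
  then obtain q where q: "continuous_map (subtopology (cw_space K) (closed_cell K c)) (poset_top F face) q"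
    and qbd: "\<And>x. x \<in> cell_boundary K c \<Longrightarrow> q x = p x"
    and qf: "\<And>x. x \<in> closed_cell K c \<Longrightarrow> q x = c \<or> q x \<in> ?F' \<and> face (q x) c"
    using extend_to_face_poset[OF cK FK c _ p pbd] by blast
  define r where "r = (\<lambda>x. if x \<in> \<Union>?F' then p x else q x)"
  \<comment> \<open>The two pieces overlap exactly in \<open>cell_boundary K c\<close>, where
    \<open>q\<close> agrees with \<open>p\<close>.\<close>
  have rq: "r x = q x" if x: "x \<in> closed_cell K c" for x
  proof (cases "x \<in> \<Union>?F'")
    case True
    have "x \<notin> c"
    proof
      assume "x \<in> c"
      moreover obtain y where "y \<in> ?F'" "x \<in> y" using True by blast
      ultimately show False using cells_meet_eq[of y c x] FK cK by blast
    qed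
    then have "x \<in> cell_boundary K c"
      using closed_cell_diff[OF cK x] unfolding cell_boundary_def by blast
    then show ?thesis using qbd True by (simp only: r_def if_True)
  qed (simp only: r_def if_False)
  let ?T = "subtopology (cw_space K) (\<Union>F)"
  have "continuous_map ?T (poset_top F face) r"
  proof (rule continuous_map_closed_Un)
    have clF: "closedin (cw_space K) (\<Union>F)" by (rule closedin_subcomplex[OF Suc.prems])
    show "closedin ?T (\<Union>?F')"
      unfolding closedin_closed_subtopology[OF clF] using closedin_subcomplex[OF sub'] by blast
    show "closedin ?T (closed_cell K c)"
      unfolding closedin_closed_subtopology[OF clF] using Fcl[OF c] by simp
    show "topspace ?T \<subseteq> \<Union>?F' \<union> closed_cell K c"
      using cell_subset_closed_cell[OF cK] unfolding topspace_subtopology by blast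
    have "\<Union>F \<inter> \<Union>?F' = \<Union>?F'" "\<Union>F \<inter> closed_cell K c = closed_cell K c"
      using Fcl[OF c] by blast+
    then have sub: "subtopology ?T (\<Union>?F') = subtopology (cw_space K) (\<Union>?F')"
      "subtopology ?T (closed_cell K c) = subtopology (cw_space K) (closed_cell K c)"
      by (simp_all only: subtopology_subtopology)
    have "continuous_map (subtopology (cw_space K) (\<Union>?F')) (poset_top F face) p"
      using continuous_map_compose[OF p continuous_map_poset_top_mono[of ?F' F]] by (simp add: o_def)
    then show "continuous_map (subtopology ?T (\<Union>?F')) (poset_top F face) r"
      unfolding sub by (rule continuous_map_eq) (simp add: r_def)
    show "continuous_map (subtopology ?T (closed_cell K c)) (poset_top F face) r"
      unfolding sub using q by (rule continuous_map_eq) (simp add: rq)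
  qed
  moreover have "r x \<in> F \<and> face (r x) y" if y: "y \<in> F" "x \<in> closed_cell K y" for x y
  proof (cases "y = c")
    case True
    then show ?thesis using qf[of x] rq[of x] y c cell_subset_closed_cell[OF cK] by auto
  next
    case False
    then have "y \<in> ?F'" using y by blast
    moreover from this have "x \<in> \<Union>?F'" using sub' y(2) unfolding subcomplex_cells_def by blast
    ultimately show ?thesis using pf[of y x] y(2) by (simp add: r_def)
  qed
  ultimately show ?case by blast
qed

lemma nullhomotopic_into_face_poset:
  assumes F: "subcomplex_cells K F" and contr: "contractible_space (subtopology (cw_space K) (\<Union>F))"
    and Z: "normal_space Z" and f: "continuous_map Z (poset_top F face) f"
  shows "\<exists>a. homotopic_with (\<lambda>_. True) Z (poset_top F face) f (\<lambda>_. a)"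
proof -
  let ?Y = "subtopology (cw_space K) (\<Union>F)"
  have FK: "F \<subseteq> cells K" and Fcl: "\<And>y. y \<in> F \<Longrightarrow> closed_cell K y \<subseteq> \<Union>F"
    using F unfolding subcomplex_cells_def by blast+
  have fin: "finite F" using FK finite_cells finite_subset by blast
  have 1: "closed_cell K a \<subseteq> topspace ?Y" if a: "a \<in> F" for a
    unfolding topspace_subtopology by (intro Int_greatest closure_of_subset_topspace Fcl a)
  have 2: "closed_cell K a \<noteq> {}" if a: "a \<in> F" for a
    using a FK cell_nonempty[of a] cell_subset_closed_cell[of a] by blast
  have 3: "contractible_space (subtopology ?Y (closed_cell K a))" if a: "a \<in> F" for a
  proof -
    have "\<Union>F \<inter> closed_cell K a = closed_cell K a" "a \<in> cells K" using Fcl[OF a] a FK by blast+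
    then show ?thesis
      using contractible_closed_cell[of a] by (simp only: subtopology_subtopology)
  qed
  have 4: "closed_cell K a \<subseteq> closed_cell K b" if "a \<in> F" "b \<in> F" "face a b" for a b
    by (rule closed_cell_mono[OF that(3)])
  obtain f' g where f': "continuous_map Z (poset_top F face) f'" and g: "continuous_map Z ?Y g"
    and fg: "\<And>z. z \<in> topspace Z \<Longrightarrow> face (f z) (f' z) \<and> g z \<in> closed_cell K (f' z)"
  proof -
    \<comment> \<open>Constraints arise inside the induction of \<open>poset_selection\<close>,
      which is started here with the empty family.\<close>
    have e: "closedin Z B \<and> openin (poset_top F face) D \<and> f ` B \<subseteq> D" if "(B, D) \<in> {}" for B D
      using that by simp
    note selection = poset_selection[where A = F and le = face and \<Phi> = "closed_cell K" and Y = ?Y and f = f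
        and Z = Z and \<B> = "{}",
        OF fin transp_face reflp_face[OF FK] antisymp_face[OF FK] 1 2 3 4 Z f finite.emptyI e]
    show ?thesis
      by (rule exE[OF selection], assumption+, elim exE conjE, rule that, assumption+, blast)
  qed
  obtain p where p: "continuous_map ?Y (poset_top F face) p"
    and pf: "\<And>y x. y \<in> F \<Longrightarrow> x \<in> closed_cell K y \<Longrightarrow> p x \<in> F \<and> face (p x) y"
    using exists_map_to_face_poset[OF F] by blast
  have "homotopic_with (\<lambda>_. True) Z (poset_top F face) f f'"
    by (rule homotopic_with_le_poset_top[OF f f']) (use fg in blast)
  moreover have "homotopic_with (\<lambda>_. True) Z (poset_top F face) (p \<circ> g) f'"
  proof (rule homotopic_with_le_poset_top[OF continuous_map_compose[OF g p] f'])
    fix z assume z: "z \<in> topspace Z"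
    then have "f' z \<in> F" using continuous_map_funspace[OF f'] unfolding topspace_poset_top by blast
    then show "face ((p \<circ> g) z) (f' z)" using pf[of "f' z" "g z"] fg[OF z] by simp
  qed
  moreover obtain a where "homotopic_with (\<lambda>_. True) Z (poset_top F face) (p \<circ> g) (\<lambda>_. a)"
    using nullhomotopic_through_contractible_space[OF g p contr] .
  ultimately show ?thesis
    by (meson homotopic_with_trans homotopic_with_symD)
qed

lemma homotopically_trivial_face_poset:
  assumes "subcomplex_cells K F" "F \<noteq> {}" "contractible_space (subtopology (cw_space K) (\<Union>F))"
  shows "homotopically_trivial (poset_top F face)"
  by (rule homotopically_trivial_if_nullhomotopic)
     (use assms nullhomotopic_into_face_poset[OF assms(1,3)] in simp_all)

section \<open>Passing to subcomplexes\<close>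

lemma closed_cell_subcomplex:
  assumes "subcomplex_cells K F" "e \<in> F"
  shows "subtopology (cw_space K) (\<Union>F) closure_of e = closed_cell K e"
proof -
  have "closed_cell K e \<subseteq> \<Union>F" "\<Union>F \<inter> e = e" using assms unfolding subcomplex_cells_def by blast+
  then show ?thesis unfolding closure_of_subtopology by (simp only: Int_absorb1)
qed

text \<open>Closed cells of \<open>L\<close> are the same in \<open>L\<close> and in
  \<open>K\<close>. Disjointness of cells ensures that a boundary point lying in the low skeleton of
  \<open>K\<close> and in \<open>L\<close> lies in the low skeleton of \<open>L\<close>.\<close>

lemma h_regular_cw_subcomplex:
  assumes "subcomplex L K"
  shows "h_regular_cw L"
proof -
  obtain F where F: "subcomplex_cells K F"
    and L: "L = K\<lparr>cw_space := subtopology (cw_space K) (\<Union>F), cells := F\<rparr>"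
    using assms unfolding subcomplex_def by blast
  have FK: "F \<subseteq> cells K" and Fcl: "\<And>y. y \<in> F \<Longrightarrow> closed_cell K y \<subseteq> \<Union>F"
    using F unfolding subcomplex_cells_def by blast+
  have L': "cw_space L = subtopology (cw_space K) (\<Union>F)" "cells L = F"
    "cell_dim L = cell_dim K" "cw.char_map L = cw.char_map K" "cell_boundary L = cell_boundary K"
    by (simp_all add: L cell_boundary_def fun_eq_iff)
  show ?thesis
  proof
    show "Hausdorff_space (cw_space L)" unfolding L' by (rule Hausdorff_space_subtopology[OF Hausdorff])
    show "finite (cells L)" unfolding L' using FK finite_cells finite_subset by blast
    have "\<Union>F \<subseteq> topspace (cw_space K)" using FK Union_cells by blast
    then show "\<Union>(cells L) = topspace (cw_space L)" unfolding L' by (simp only: topspace_subtopology_subset)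
    show "pairwise disjnt (cells L)" unfolding L' by (rule pairwise_subset[OF disjoint_cells FK])
    show "characteristic_map L e (ball_top (cell_dim L e)) (ball_bd (cell_dim L e)) (cw.char_map L e)"
      if "e \<in> cells L" for e
    proof -
      have e: "e \<in> F" "e \<in> cells K" using that FK unfolding L' by blast+
      have eF: "\<Union>F \<inter> e = e" using e by blast
      have skel: "cw.char_map K e ` ball_bd (cell_dim K e) \<subseteq> skeleton L (int (cell_dim K e) - 1)"
      proof
        fix x assume x: "x \<in> cw.char_map K e ` ball_bd (cell_dim K e)"
        then have "x \<in> skeleton K (int (cell_dim K e) - 1)" using char_map_bd[OF e(2)] by blast
        then obtain g where g: "g \<in> cells K" "int (cell_dim K g) \<le> int (cell_dim K e) - 1" "x \<in> g"
          unfolding skeleton_def by blast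
        have "x \<in> \<Union>F"
          using x cell_boundary_subset[OF e(2)] Fcl[OF e(1)] unfolding cell_boundary_def by blast
        then obtain h where "h \<in> F" "x \<in> h" by blast
        then have "g \<in> F" using cells_meet_eq[of g h x] g FK by blast
        then show "x \<in> skeleton L (int (cell_dim K e) - 1)"
          using g unfolding skeleton_def L' by blast
      qed
      have "cw.char_map K e \<in> topspace (ball_top (cell_dim K e)) \<rightarrow> \<Union>F"
        using char_map_image(3)[OF e(2)] Fcl[OF e(1)] by blast
      then show ?thesis
        using char_map[OF e(2)] skel
        unfolding characteristic_map_def L' subtopology_subtopology eF continuous_map_in_subtopology
        by blast
    qed
    show "h_regular L"
      unfolding h_regular_def
    proof (intro ballI conjI)
      fix e assume "e \<in> cells L"
      then have e: "e \<in> F" "e \<in> cells K" using FK unfolding L' by blast+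
      have bF: "\<Union>F \<inter> cell_boundary K e = cell_boundary K e"
        using cell_boundary_subset[OF e(2)] Fcl[OF e(1)] by blast
      note hr = bspec[OF h_regular[unfolded h_regular_def] e(2)]
      show "homotopy_equivalence_map
          (subtopology (Euclidean_space (cell_dim L e)) (ball_bd (cell_dim L e)))
          (subtopology (cw_space L) (cell_boundary L e)) (cw.char_map L e)"
        using conjunct1[OF hr] unfolding L' subtopology_subtopology bF .
      obtain G where G: "subcomplex_cells K G" "closed_cell K e = \<Union>G"
        using conjunct2[OF hr] by blast
      have GF: "G \<subseteq> F"
      proof
        fix g assume g: "g \<in> G"
        then have "g \<in> cells K" "face g e" using G unfolding subcomplex_cells_def by blast+
        then show "g \<in> F" using subcomplex_cells_down[OF F e(1)] by blast
      qed
      have "subcomplex_cells L G"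
        unfolding subcomplex_cells_def L'
      proof (intro conjI ballI GF)
        fix g assume g: "g \<in> G"
        have "subtopology (cw_space K) (\<Union>F) closure_of g = closed_cell K g"
          by (rule closed_cell_subcomplex[OF F]) (use g GF in blast)
        then show "subtopology (cw_space K) (\<Union>F) closure_of g \<subseteq> \<Union>G"
          using G(1) g unfolding subcomplex_cells_def by blast
      qed
      then show "\<exists>G. subcomplex_cells L G \<and> closed_cell L e = \<Union>G"
        unfolding L' closed_cell_subcomplex[OF F e(1)] using G(2) by blast
    qed
  qed
qed

text \<open>This places the face posets before and after a collapse in one relation, so that
  removing points from the first produces the second literally.\<close>

lemma face_poset_subcomplex:
  assumes "subcomplex L K"
  shows "face_poset L = poset_top (cells L) face"
proof -
  obtain F where F: "subcomplex_cells K F"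
    and L: "cw_space L = subtopology (cw_space K) (\<Union>F)" "cells L = F"
    using assms unfolding subcomplex_def by force
  show ?thesis
    unfolding face_poset_def L by (rule poset_top_cong) (simp only: closed_cell_subcomplex[OF F])
qed

end

section \<open>Collapses\<close>

context h_regular_cw
begin

lemma elementary_collapse_gamma:
  assumes "elementary_collapse K L"
  shows "\<exists>X. elementary_gamma_collapse (face_poset K) X \<and> elementary_gamma_collapse X (face_poset L)"
proof -
  have LK: "subcomplex L K" using assms unfolding elementary_collapse_def by blast
  obtain n e e' Q S B T \<phi> where eL: "e \<notin> cells L" and e'L: "e' \<notin> cells L"
    and cellsK: "cells K = cells L \<union> {e, e'}"
    and dim: "cell_dim K e = n" "cell_dim K e' = Suc n"
    and bp: "ball_pair n Q S B T" and \<phi>': "characteristic_map K e' Q S \<phi>"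
    and \<phi>: "characteristic_map K e (subtopology Q B) T \<phi>"
    and \<phi>L: "\<phi> ` (Q closure_of (S - B)) \<subseteq> skeleton L (int n)"
    using assms unfolding elementary_collapse_def by (elim conjE exE) (rule that)
  obtain h where h: "homeomorphic_map (cube_top (Suc n)) Q h"
    and S: "S = h ` cube_bd (Suc n)" and B: "B = h ` topspace (cube_top n)" and T: "T = h ` cube_bd n"
    using bp unfolding ball_pair_def by (elim conjE exE) (rule that)
  let ?I = "topspace (cube_top (Suc n))" and ?J = "topspace (cube_top n)"
  have IJ: "?J \<subseteq> ?I" "?J \<subseteq> cube_bd (Suc n)" "cube_bd n \<subseteq> ?J" "cube_bd (Suc n) \<subseteq> ?I" "open_box n \<subseteq> ?I"
    using bottom_face_subset[of n] bottom_face_subset(3)[of "Suc n"]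
    unfolding topspace_cube_top open_box_def by blast+
  have inj: "inj_on h ?I" and hI: "h ` ?I = topspace Q"
    using homeomorphic_imp_injective_map[OF h] homeomorphic_imp_surjective_map[OF h] .
  have Lsub: "subcomplex_cells K (cells L)"
    using LK unfolding subcomplex_def by force
  have LcK: "cells L \<subseteq> cells K" using Lsub unfolding subcomplex_cells_def by blast
  have eK: "e \<in> cells K" and e'K: "e' \<in> cells K" using cellsK by blast+
  have ee': "e \<noteq> e'" using dim by auto
  have eU: "x \<notin> \<Union>(cells L)" "x \<notin> e'" if "x \<in> e" for x
    using that cells_meet_eq[OF eK _ that] eL ee' e'K LcK by blast+
  have e'U: "x \<notin> \<Union>(cells L)" if "x \<in> e'" for x
    using that cells_meet_eq[OF e'K _ that] e'L LcK by blast

  \<comment> \<open>The given characteristic map is read on the standard cube, where it describes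
    both cells at once: the interior of the cube gives \<open>e'\<close> and the interior of the
    bottom face gives \<open>e\<close>.\<close>
  define \<psi> where "\<psi> = \<phi> \<circ> h"
  have \<psi>im: "\<psi> ` M = \<phi> ` (h ` M)" for M unfolding \<psi>_def by (rule image_comp[symmetric])
  have topQS: "topspace Q - S = h ` (?I - cube_bd (Suc n))"
    unfolding S hI[symmetric] by (rule inj_on_image_set_diff[OF inj, symmetric]) (use IJ in blast)+
  have BQ: "B \<subseteq> topspace Q" unfolding B hI[symmetric] using IJ by blast
  have topBT: "topspace (subtopology Q B) - T = h ` (?J - cube_bd n)"
    unfolding topspace_subtopology_subset[OF BQ] unfolding B T
    by (rule inj_on_image_set_diff[OF inj, symmetric]) (use IJ in blast)+
  have SB: "S - B = h ` (cube_bd (Suc n) - ?J)"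
    unfolding S B by (rule inj_on_image_set_diff[OF inj, symmetric]) (use IJ in blast)+
  have Qcomp: "compact_space Q"
    using homeomorphic_compact_space[OF homeomorphic_map_imp_homeomorphic_space[OF h]]
      compact_space_cube_top by blast
  have dense: "topspace Q \<subseteq> Q closure_of (topspace Q - S)"
  proof -
    have "h ` ?I \<subseteq> h ` (cube_top (Suc n) closure_of (?I - cube_bd (Suc n)))"
      by (rule image_mono[OF cube_top_dense])
    also have "\<dots> = Q closure_of (h ` (?I - cube_bd (Suc n)))"
      by (rule homeomorphic_map_closure_of[OF h, symmetric]) blast
    finally show ?thesis unfolding topQS hI .
  qed
  have \<psi>cont: "continuous_map (cube_top (Suc n)) (cw_space K) \<psi>"
    unfolding \<psi>_def using \<phi>' unfolding characteristic_map_def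
    by (intro continuous_map_compose[OF homeomorphic_imp_continuous_map[OF h]]) blast
  have \<psi>e': "\<psi> ` (?I - cube_bd (Suc n)) = e'"
    unfolding \<psi>im topQS[symmetric]
    by (rule characteristic_map_interior(1)[OF \<phi>' cell_subset_topspace[OF e'K]])
  have "inj_on \<phi> (h ` (?I - cube_bd (Suc n)))"
    unfolding topQS[symmetric] by (rule characteristic_map_interior(2)[OF \<phi>' cell_subset_topspace[OF e'K]])
  then have inj': "inj_on \<psi> (?I - cube_bd (Suc n))"
    unfolding \<psi>_def by (intro comp_inj_on inj_on_subset[OF inj]) blast
  have \<psi>e: "\<psi> ` (?J - cube_bd n) = e"
    unfolding \<psi>im topBT[symmetric]
    by (rule characteristic_map_interior(1)[OF \<phi> cell_subset_topspace[OF eK]])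
  have "inj_on \<phi> (h ` (?J - cube_bd n))"
    unfolding topBT[symmetric] by (rule characteristic_map_interior(2)[OF \<phi> cell_subset_topspace[OF eK]])
  then have inj_e: "inj_on \<psi> (?J - cube_bd n)"
    unfolding \<psi>_def by (intro comp_inj_on inj_on_subset[OF inj]) (use IJ in blast)+
  have \<psi>cl: "\<psi> ` ?I = closed_cell K e'"
    unfolding \<psi>im hI
    by (rule characteristic_map_image[OF \<phi>' Qcomp Hausdorff cell_subset_topspace[OF e'K] dense])
  have \<psi>L: "\<psi> x \<in> \<Union>(cells L)" if x: "x \<in> open_box n" for x
  \<comment> \<open>A point of \<open>open_box n\<close> in the bottom face lies on the rim of that
    face, which goes to cells of dimension below \<open>n\<close>, hence neither to \<open>e\<close>
    nor to \<open>e'\<close>. All other points lie in \<open>S - B\<close>, where the definition of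
    a collapse applies.\<close>
  proof (cases "x \<in> ?J")
    case True
    then have "x n = 0" by auto
    then have "x \<in> cube_bd n" using True x by (auto simp: open_box_def cube_bd_eq)
    then have "\<psi> x \<in> \<phi> ` T" unfolding T \<psi>_def o_def by blast
    then have "\<psi> x \<in> skeleton K (int n - 1)"
      using \<phi> dim(1) unfolding characteristic_map_def by blast
    then obtain g where g: "g \<in> cells K" "int (cell_dim K g) \<le> int n - 1" "\<psi> x \<in> g"
      unfolding skeleton_def by blast
    then have "g \<noteq> e" "g \<noteq> e'" using dim by auto
    then show ?thesis using g cellsK by blast
  next
    case False
    then have "x \<in> cube_bd (Suc n)"
      using x by (auto simp: open_box_def cube_bd_eq less_Suc_eq)
    then have "h x \<in> S - B" unfolding SB using False by blast
    moreover have "S - B \<subseteq> Q closure_of (S - B)"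
      by (rule closure_of_subset) (use IJ in \<open>unfold S hI[symmetric], blast\<close>)
    ultimately have "\<psi> x \<in> skeleton L (int n)" using \<phi>L unfolding \<psi>_def o_def by blast
    then show ?thesis unfolding skeleton_def by blast
  qed
  have cases: "x \<in> ?I - cube_bd (Suc n) \<or> x \<in> ?J - cube_bd n \<or> x \<in> open_box n" if "x \<in> ?I" for x
    using that cube_Suc_cases[of x n] unfolding topspace_cube_top by blast
  have in_e': "\<psi> x \<in> e'" if "x \<in> ?I - cube_bd (Suc n)" for x
    unfolding \<psi>e'[symmetric] by (rule imageI[OF that])
  have in_e: "\<psi> x \<in> e" if "x \<in> ?J - cube_bd n" for x
    unfolding \<psi>e[symmetric] by (rule imageI[OF that])
  \<comment> \<open>The three pieces of the cube go to the disjoint sets \<open>e'\<close>,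
    \<open>e\<close> and \<open>\<Union>(cells L)\<close>, and the first two injectively.
    Identifications therefore occur only within \<open>open_box n\<close>.\<close>
  have fibres: "x = y \<or> x \<in> open_box n \<and> y \<in> open_box n"
    if xy: "x \<in> ?I" "y \<in> ?I" and eq: "\<psi> x = \<psi> y" for x y
    using cases[OF xy(1)] cases[OF xy(2)]
  proof (elim disjE)
    assume "x \<in> ?I - cube_bd (Suc n)" "y \<in> ?I - cube_bd (Suc n)"
    then show ?thesis using inj_on_eq_iff[OF inj', of x y] eq by blast
  next
    assume "x \<in> ?J - cube_bd n" "y \<in> ?J - cube_bd n"
    then show ?thesis using inj_on_eq_iff[OF inj_e, of x y] eq by blast
  next
    assume "x \<in> open_box n" "y \<in> open_box n"
    then show ?thesis by (simp only: simp_thms)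
  qed (use in_e in_e' \<psi>L eU e'U eq in metis)+

  let ?C = "closed_cell K e'"
  let ?L' = "?C \<inter> \<Union>(cells L)"
  have quot: "quotient_map (cube_top (Suc n)) (subtopology (cw_space K) ?C) \<psi>"
  proof (rule continuous_imp_quotient_map[OF _ compact_space_cube_top])
    show "continuous_map (cube_top (Suc n)) (subtopology (cw_space K) ?C) \<psi>"
      unfolding continuous_map_in_subtopology using \<psi>cont \<psi>cl by blast
    show "\<psi> ` ?I = topspace (subtopology (cw_space K) ?C)"
      unfolding \<psi>cl using closure_of_subset_topspace[of "cw_space K" e']
      by (simp only: topspace_subtopology_subset)
  qed (rule Hausdorff_space_subtopology[OF Hausdorff])
  have retr: "box_retraction n x \<in> open_box n" if "x \<in> ?I" for x
    using that unfolding topspace_cube_top by (rule box_retraction_in_open_box)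
  \<comment> \<open>The retraction fixes \<open>open_box n\<close> pointwise, so this map respects
    all identifications made by \<open>\<psi>\<close> and descends to a retraction of the closed
    cell of \<open>e'\<close> onto \<open>?L'\<close>.\<close>
  define \<psi>r where "\<psi>r = (\<lambda>x. \<psi> (box_retraction n x))"
  have "continuous_map (cube_top (Suc n)) (cw_space K) \<psi>r"
    unfolding \<psi>r_def
    by (rule continuous_map_compose[OF continuous_map_box_retraction \<psi>cont, unfolded o_def])
  moreover have "\<psi>r x \<in> ?L'" if "x \<in> ?I" for x
    using \<psi>L[OF retr[OF that]] retr[OF that] IJ(5) \<psi>cl unfolding \<psi>r_def by blast
  ultimately have \<psi>r: "continuous_map (cube_top (Suc n)) (subtopology (cw_space K) ?L') \<psi>r"
    unfolding continuous_map_in_subtopology by blast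
  have \<psi>r_id: "\<psi>r x = \<psi> x" if "x \<in> open_box n" for x
    unfolding \<psi>r_def box_retraction_open_box[OF that] ..
  have \<psi>r_fib: "\<psi>r x = \<psi>r y" if "x \<in> ?I" "y \<in> ?I" "\<psi> x = \<psi> y" for x y
    using fibres[OF that] \<psi>r_id[of x] \<psi>r_id[of y] that(3) by metis
  obtain \<rho> where \<rho>: "continuous_map (subtopology (cw_space K) ?C) (subtopology (cw_space K) ?L') \<rho>"
    and \<rho>\<psi>: "\<And>x. x \<in> ?I \<Longrightarrow> \<rho> (\<psi> x) = \<psi>r x"
    using quotient_map_lift_exists[OF quot \<psi>r] \<psi>r_fib by metis
  have contr: "contractible_space (subtopology (cw_space K) ?L')"
  proof (rule contractible_space_retract[OF contractible_closed_cell[OF e'K] _ \<rho>])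
    fix z assume z: "z \<in> ?L'"
    then have "z \<in> \<psi> ` ?I" unfolding \<psi>cl by blast
    then obtain x where x: "x \<in> ?I" "z = \<psi> x" by blast
    then have "x \<in> open_box n"
      using cases[OF x(1)] in_e[of x] in_e'[of x] eU(1)[of z] e'U[of z] z by blast
    then show "\<rho> z = z" using \<rho>\<psi>[OF x(1)] \<psi>r_id[of x] x(2) by simp
  qed blast

  define F where "F = {y \<in> cells L. face y e'}"
  have UF: "\<Union>F = ?L'"
  proof
    show "\<Union>F \<subseteq> ?L'" unfolding F_def by blast
    show "?L' \<subseteq> \<Union>F"
    proof
      fix z assume z: "z \<in> ?L'"
      then obtain y where "y \<in> cells L" "z \<in> y" by blast
      moreover from this have "face y e'" using face_if_meets[OF e'K, of y z] z LcK by blast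
      ultimately show "z \<in> \<Union>F" unfolding F_def by blast
    qed
  qed
  have Fsub: "subcomplex_cells K F"
    unfolding subcomplex_cells_def UF
  proof (intro conjI ballI)
    show "F \<subseteq> cells K" unfolding F_def using LcK by blast
    fix y assume y: "y \<in> F"
    then have "closed_cell K y \<subseteq> ?C" unfolding F_def using closed_cell_mono by blast
    moreover have "closed_cell K y \<subseteq> \<Union>(cells L)"
      using y Lsub unfolding F_def subcomplex_cells_def by blast
    ultimately show "closed_cell K y \<subseteq> ?L'" by blast
  qed
  have "F \<noteq> {}"
  proof -
    \<comment> \<open>A vertex of the top face of the cube, present even for
      \<open>n = 0\<close>.\<close>
    have o: "(\<lambda>i. if i = n then 1 else 0) \<in> open_box n" by (simp add: open_box_def)
    then have "(\<lambda>i. if i = n then 1 else 0) \<in> ?I" using IJ(5) by blast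
    then have "\<psi> (\<lambda>i. if i = n then 1 else 0) \<in> ?C" unfolding \<psi>cl[symmetric] by (rule imageI)
    then have "\<psi> (\<lambda>i. if i = n then 1 else 0) \<in> \<Union>F" unfolding UF using \<psi>L[OF o] by blast
    then show ?thesis by blast
  qed
  then have triv: "homotopically_trivial (poset_top F face)"
    by (rule homotopically_trivial_face_poset[OF Fsub]) (unfold UF, rule contr)

  \<comment> \<open>Subcomplexes are closed under faces, so no removed cell lies below a remaining
    one. Thus only \<open>e'\<close> lies properly above \<open>e\<close>, and nothing lies properly
    above \<open>e'\<close>.\<close>
  have not_face: "\<not> face c y" if "y \<in> cells L" "c \<in> cells K" "c \<notin> cells L" for c y
    using subcomplex_cells_down[OF Lsub that(1,2)] that(3) by blast
  have fe: "face e e'"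
    unfolding \<psi>e[symmetric] \<psi>cl[symmetric] using IJ(1) by blast
  have "elementary_gamma_collapse (poset_top (cells K) face) (poset_top (cells K - {e}) face)"
  proof (rule elementary_gamma_collapse_poset_top[OF finite_cells reflp_face transp_face antisymp_face eK])
    let ?A = "{y \<in> cells K. y \<noteq> e \<and> (face e y \<or> face y e)}"
    have top: "e' \<in> ?A" using e'K ee' fe by blast
    have "face y e'" if y: "y \<in> ?A" for y
    proof (cases "face y e")
      case True
      then show ?thesis using closed_cell_mono[OF fe] by blast
    next
      case False
      then have "y = e'" using y not_face[OF _ eK eL, of y] cellsK by blast
      then show ?thesis using cell_subset_closed_cell[OF e'K] by simp
    qed
    with top have "contractible_space (poset_top ?A face)" by (rule contractible_poset_top_with_top)
    moreover have "topspace (poset_top ?A face) \<noteq> {}" unfolding topspace_poset_top using top by blast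
    ultimately show "homotopically_trivial (poset_top ?A face)"
      by (rule homotopically_trivial_contractible[rotated])
  qed simp_all
  moreover have "elementary_gamma_collapse (poset_top (cells K - {e}) face)
      (poset_top (cells K - {e} - {e'}) face)"
  proof (rule elementary_gamma_collapse_poset_top[OF _ reflp_face transp_face antisymp_face])
    \<comment> \<open>Once \<open>e\<close> is gone, the cells comparable with \<open>e'\<close> are
      its faces in \<open>L\<close>.\<close>
    have "{y \<in> cells K - {e}. y \<noteq> e' \<and> (face e' y \<or> face y e')} = F"
      unfolding F_def cellsK using not_face[OF _ e'K e'L] eL e'L by blast
    then show "homotopically_trivial (poset_top {y \<in> cells K - {e}. y \<noteq> e' \<and> (face e' y \<or> face y e')} face)"
      using triv by (simp only:)
  qed (use finite_cells e'K ee' in auto)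
  moreover have "cells K - {e} - {e'} = cells L" using cellsK eL e'L by blast
  ultimately show ?thesis
    unfolding face_poset_subcomplex[OF LK] face_poset_def[of K] by metis
qed

end

lemma h_regular_cwI:
  assumes "finite_cw_complex K" "h_regular K"
  shows "h_regular_cw K"
  using assms unfolding finite_cw_complex_def cw_complex_def by unfold_locales blast+

theorem theorem4p9:
  fixes K L :: "'a cw"
  assumes "finite_cw_complex K"
    and "h_regular K"
    and "subcomplex L K"
    and "collapses K L"
  shows "gamma_collapses (face_poset K) (face_poset L)"
proof -
  \<comment> \<open>The induction takes off the first collapse, so the starting complex varies; its
    regularity is carried as a premise and passed on to the next complex.\<close>
  have "h_regular_cw K \<longrightarrow> gamma_collapses (face_poset K) (face_poset L)"
    using assms(4) unfolding collapses_def
  proof (induction rule: converse_rtranclp_induct)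
    case base
    show ?case unfolding gamma_collapses_def by blast
  next
    case (step K K')
    show ?case
    proof
      assume "h_regular_cw K"
      then interpret h_regular_cw K .
      have "h_regular_cw K'"
        by (rule h_regular_cw_subcomplex) (use step.hyps(1) in \<open>simp add: elementary_collapse_def\<close>)
      then have "gamma_collapses (face_poset K') (face_poset L)" using step.IH by blast
      moreover obtain X where "elementary_gamma_collapse (face_poset K) X"
        "elementary_gamma_collapse X (face_poset K')"
        using elementary_collapse_gamma[OF step.hyps(1)] by blast
      ultimately show "gamma_collapses (face_poset K) (face_poset L)"
        unfolding gamma_collapses_def by (meson converse_rtranclp_into_rtranclp)
    qed
  qed
  then show ?thesis using h_regular_cwI[OF assms(1,2)] by blast
qed

end
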